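(* For all weak compositions $\alpha$ and $\beta$, the renormalized monomial quasisymmetric functions satisfy $$M_\alpha M_\beta=M_{\alpha*\beta},$$ where $*$ is the quasi-shuffle product of weak compositions and $M$ is extended linearly. Consequently, the set $\mathrm{RenQSym}$ of all $\mathbf k$-linear combinations of renormalized monomial quasisymmetric functions is a subalgebra of $\mathbf k[[X]][t]$.
   Context: $\mathbf k$ is a commutative ring containing $\mathbb Q$. $\mathbb P$ and $\mathbb N$ denote the positive and nonnegative integers. A weak composition is a finite sequence of nonnegative integers, possibly empty. Let $X=\{x_i:i\in\mathbb P\}$ be commuting indeterminates. Quasi-shuffle of weak compositions. $\emptyset$ is the unit, and $$a*b=(a_1,(a_2,\dots,a_m)*b)+(b_1,a*(b_2,\dots,b_n))+(a_1+b_1,(a_2,\dots,a_m)*(b_2,\dots,b_n)),$$ with $(c,\sum\lambda_uu)=\sum\lambda_u(c,u)$. The same rule, with columns added componentwise, defines the quasi-shuffle product on matrices $\binom{\alpha}{\beta}$ with $\alpha\in\mathbb N^k$, $\beta\in\mathbb P^k$. GSym. $\mathrm{GSym}\subseteq\mathbb Q[[X]]$ is the $\mathbb Q$-span of $\widehat M_{\binom{\gamma}{\mu}}=\sum_{0<i_1<\cdots<i_r}i_1^{\mu_1}\cdots i_r^{\mu_r}x_{i_1}^{\gamma_1}\cdots x_{i_r}^{\gamma_r}$, for $\gamma\in\mathbb N^r$ with $r=0$ or $\gamma_r>0$, and $\mu\in\mathbb N^r$. Regularization. For $\alpha\in\mathbb N^k$, $\beta\in\mathbb P^k$, $\phi\binom{\alpha}{\beta}\in\mathrm{GSym}[t][z^{-1},z]]$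 is obtained from $\sum_{0<i_1<\cdots<i_k}\prod_l x_{i_l}^{\alpha_l}e^{(i_l+t)\beta_lz}$. The coefficient of each $X$-monomial converges absolutely for $t\ge0$, $\mathrm{Re}(z)<0$; it is expanded as a Laurent series in $z$ with coefficients in $\mathbb Q[t]$, and powers are collected. Renormalization. Let $P$ be the polar-part projection in $z$. Set $\phi_-(\emptyset)=1$ and $$\phi_\mp\tbinom{\alpha}{\beta}=\{-P,\ \mathrm{id}-P\}\Big(\phi\tbinom{\alpha}{\beta}+\sum_{i=1}^{k-1}\phi\tbinom{\alpha_1..\alpha_i}{\beta_1..\beta_i}\phi_-\tbinom{\alpha_{i+1}..\alpha_k}{\beta_{i+1}..\beta_k}\Big),$$ i.e. $\phi_-$ uses $-P$ and $\phi_+$ uses $\mathrm{id}-P$. Put $Z\binom{\alpha}{\beta}=\phi_+\binom{\alpha}{\beta}|_{z=0}\in\mathrm{GSym}[t]$. Renormalized monomial quasisymmetric functions. For a weak composition $\alpha$ of length $k$, $M_\alpha:=Z\binom{\alpha}{\delta,\dots,\delta}$ for $\delta\in\mathbb P$; this does not depend on $\delta$. Also $M_\emptyset=1$. When the last entry of $\alpha$ is positive, $M_\alpha=\sum_{0<i_1<\cdots<i_k}x_{i_1}^{\alpha_1}\cdots x_{i_k}^{\alpha_k}$. *)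

theory Defs
  imports "HOL-Complex_Analysis.Complex_Analysis" "HOL-Library.Poly_Mapping"
    "HOL-Library.Multiset" "HOL-Computational_Algebra.Polynomial"
    "HOL-Computational_Algebra.Formal_Laurent_Series"
begin

text \<open>An X-monomial is a finitely supported exponent vector; a formal power series in X
  with coefficients in a ring A is a function from monomials to A.\<close>

type_synonym xmono = "nat \<Rightarrow>\<^sub>0 nat"
type_synonym 'a xser = "xmono \<Rightarrow> 'a"

definition xmul :: "'a::comm_ring_1 xser \<Rightarrow> 'a xser \<Rightarrow> 'a xser" where
  "xmul f g = (\<lambda>m. \<Sum>(a, b) \<in> {(a, b). a + b = m}. f a * g b)"

definition xone :: "'a::comm_ring_1 xser" where
  "xone = (\<lambda>m. if m = 0 then 1 else 0)"

section \<open>Quasi-shuffle of weak compositions (formal N-linear combination = multiset)\<close>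

fun qsh :: "nat list \<Rightarrow> nat list \<Rightarrow> nat list multiset" where
  "qsh [] b = {#b#}"
| "qsh a [] = {#a#}"
| "qsh (x # a) (y # b) =
     image_mset (Cons x) (qsh a (y # b)) + image_mset (Cons y) (qsh (x # a) b)
     + image_mset (Cons (x + y)) (qsh a b)"

text \<open>A matrix (alpha over beta) of length k is a list of k columns (alpha_l, beta_l).\<close>

definition mono_of :: "nat list \<Rightarrow> nat list \<Rightarrow> xmono" where
  "mono_of i a = (\<Sum>l<length i. Poly_Mapping.single (i ! l) (a ! l))"

definition idx_set :: "(nat \<times> nat) list \<Rightarrow> xmono \<Rightarrow> nat list set" where
  "idx_set w m = {i. length i = length w \<and> sorted_wrt (<) i \<and> (\<forall>j\<in>set i. 0 < j)
                     \<and> mono_of i (map fst w) = m}"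

text \<open>Coefficient of the monomial m in the sum of prod_l x^alpha_l e^((i_l+t) beta_l z).\<close>
definition phi_fun :: "(nat \<times> nat) list \<Rightarrow> xmono \<Rightarrow> real \<Rightarrow> complex \<Rightarrow> complex" where
  "phi_fun w m t z = (\<Sum>\<^sub>\<infinity> i \<in> idx_set w m.
      exp (z * (\<Sum>l<length w. (of_nat (i ! l) + complex_of_real t) * of_nat (snd (w ! l)))))"

definition eval_t :: "rat poly fls \<Rightarrow> real \<Rightarrow> complex fls" where
  "eval_t F t = Abs_fls (\<lambda>n. poly (map_poly of_rat (fls_nth F n)) (complex_of_real t))"

definition laurent_left :: "complex fls \<Rightarrow> (complex \<Rightarrow> complex) \<Rightarrow> bool" where
  "laurent_left F f \<longleftrightarrow> fls_conv_radius F > 0 \<and>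
      eventually (\<lambda>z. f z = eval_fls F z) (at 0 within {z. Re z < 0})"

definition phi :: "(nat \<times> nat) list \<Rightarrow> rat poly fls xser" where
  "phi w m = (THE F. \<forall>t\<ge>0. laurent_left (eval_t F t) (phi_fun w m t))"

definition polP :: "rat poly fls \<Rightarrow> rat poly fls" where
  "polP F = F - fps_to_fls (fls_regpart F)"

function phi_minus :: "(nat \<times> nat) list \<Rightarrow> rat poly fls xser" where
  "phi_minus w = (if w = [] then xone else
     (\<lambda>m. - polP (phi w m +
        (\<Sum>i\<in>{1..<length w}. xmul (phi (take i w)) (phi_minus (drop i w)) m))))"
  by pat_completeness auto
termination by (relation "Wellfounded.measure length") auto

definition phi_plus :: "(nat \<times> nat) list \<Rightarrow> rat poly fls xser" where
  "phi_plus w = (\<lambda>m. (phi w m +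
        (\<Sum>i\<in>{1..<length w}. xmul (phi (take i w)) (phi_minus (drop i w)) m))
      - polP (phi w m +
        (\<Sum>i\<in>{1..<length w}. xmul (phi (take i w)) (phi_minus (drop i w)) m)))"

definition Zren :: "(nat \<times> nat) list \<Rightarrow> rat poly xser" where
  "Zren w = (\<lambda>m. fls_nth (phi_plus w m) 0)"

text \<open>Renormalized monomial quasisymmetric function, with rational coefficients
  (taking delta = 1 in the bottom row).\<close>
definition Mq :: "nat list \<Rightarrow> rat poly xser" where
  "Mq a = (if a = [] then xone else Zren (map (\<lambda>x. (x, 1)) a))"

section \<open>Scalars in a commutative ring k containing Q\<close>

definition ratk :: "rat \<Rightarrow> 'k::comm_ring_1" where
  "ratk q = (case quotient_of q of (a, b) \<Rightarrow> of_int a * (SOME y. of_int b * y = 1))"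

definition Mk :: "nat list \<Rightarrow> 'k::comm_ring_1 poly xser" where
  "Mk a = (\<lambda>m. map_poly ratk (Mq a m))"

definition RenQSym :: "'k::comm_ring_1 poly xser set" where
  "RenQSym = {f. \<exists>S c. finite S \<and> f = (\<lambda>m. \<Sum>g\<in>S. smult (c g) (Mk g m))}"

end

theory Submission
  imports Defs
begin

text \<open>
  Only words with bottom row \<open>(1, \<dots>, 1)\<close> matter. Write a weak composition as \<open>u 0\<^sup>k\<close>, where \<open>u\<close> is
  empty or ends in a positive entry. In the coefficient of a fixed monomial the indices belonging to
  \<open>u\<close> run over a finite set, and for last such index \<open>n\<close> the trailing zeros contribute the
  coefficient of \<open>y\<^sup>k\<close> in \<open>\<Prod>\<^sub>i\<^sub>>\<^sub>n (1 + y exp((i + t) z))\<close>. By Newton's identities this product has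
  logarithm \<open>\<Sum>\<^sub>r (-1)^(r-1) (y^r / r) (- 1 / (r z) - (t + n + 1/2) + O(z))\<close>, whose polar part depends
  neither on \<open>t\<close> nor on \<open>n\<close>. Hence multiplying by \<open>exp (\<Sum>\<^sub>r (-1)^(r-1) y^r / (r\<^sup>2 z))\<close> removes all
  poles. By uniqueness of the Birkhoff factorization this factor carries the counterterms, which are
  thus supported on the words \<open>0\<^sup>k\<close>, and renormalization replaces the product by
  \<open>(1 + y) powr -(t + n + 1/2)\<close>.

  So a coefficient of \<open>M\<^sub>\<alpha>\<close> is a polynomial in \<open>t\<close> whose value at \<open>t = -N - 1/2\<close>, for every large
  integer \<open>N\<close>, is the corresponding coefficient of the finite sum with all indices bounded by \<open>N\<close>.
  Those finite sums satisfy the quasi-shuffle relations, and polynomials that agree at infinitely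
  many points are equal.
\<close>

section \<open>Homomorphisms of commutative rings acting on coefficients\<close>

locale comm_ring_hom =
  fixes h :: "'a::comm_ring_1 \<Rightarrow> 'b::comm_ring_1"
  assumes hom_add: "h (x + y) = h x + h y"
    and hom_mult: "h (x * y) = h x * h y"
    and hom_one: "h 1 = 1"
begin

lemma hom_zero: "h 0 = 0"
  using hom_add[of 0 0] by simp

lemma hom_uminus: "h (- x) = - h x"
  using hom_add[of x "- x"] hom_zero by (simp add: eq_neg_iff_add_eq_0 add.commute)

lemma hom_diff: "h (x - y) = h x - h y"
  using hom_add[of x "- y"] hom_uminus by simp

lemma hom_sum: "h (sum f A) = (\<Sum>x\<in>A. h (f x))"
  by (induction A rule: infinite_finite_induct) (auto simp: hom_zero hom_add)

lemma hom_sum_mset: "h (\<Sum>x\<in>#A. f x) = (\<Sum>x\<in>#A. h (f x))"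
  by (induction A) (auto simp: hom_zero hom_add)

lemma hom_power: "h (x ^ n) = h x ^ n"
  by (induction n) (auto simp: hom_one hom_mult)

lemma hom_prod: "h (prod f A) = (\<Prod>x\<in>A. h (f x))"
  by (induction A rule: infinite_finite_induct) (auto simp: hom_one hom_mult)

lemma hom_of_nat: "h (of_nat n) = of_nat n"
  by (induction n) (auto simp: hom_zero hom_one hom_add)

end

lemma comm_ring_hom_divide:
  fixes h :: "'a::field \<Rightarrow> 'b::field"
  assumes "comm_ring_hom h" "y \<noteq> 0"
  shows "h (x / y) = h x / h y"
proof -
  interpret comm_ring_hom h by fact
  have "h (x / y) * h y = h x" and "h y * h (inverse y) = 1"
    using assms(2) by (simp_all flip: hom_mult add: hom_one)
  thus ?thesis by (metis nonzero_eq_divide_eq mult_zero_left zero_neq_one)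
qed

lemma comm_ring_hom_of_rat: "comm_ring_hom (of_rat :: rat \<Rightarrow> 'a::field_char_0)"
  by standard (auto simp: of_rat_add of_rat_mult)

lemma comm_ring_hom_const_poly: "comm_ring_hom (\<lambda>c::'a::comm_ring_1. [:c:])"
  by standard auto

lemma comm_ring_hom_map_poly:
  assumes "comm_ring_hom h"
  shows "comm_ring_hom (map_poly h)"
proof -
  interpret comm_ring_hom h by fact
  show ?thesis
    by standard
      (simp_all add: poly_eq_iff coeff_map_poly coeff_mult hom_zero hom_add hom_sum hom_mult hom_one)
qed

definition fps_map :: "('a \<Rightarrow> 'b) \<Rightarrow> 'a fps \<Rightarrow> 'b fps" where
  "fps_map h f = Abs_fps (\<lambda>n. h (fps_nth f n))"

lemma fps_map_nth [simp]: "fps_nth (fps_map h f) n = h (fps_nth f n)"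
  by (simp add: fps_map_def)

lemma comm_ring_hom_fps_map:
  assumes "comm_ring_hom h"
  shows "comm_ring_hom (fps_map h)"
proof -
  interpret comm_ring_hom h by fact
  show ?thesis
    by standard (simp_all add: fps_eq_iff fps_mult_nth hom_zero hom_add hom_sum hom_mult hom_one)
qed

definition fls_map :: "('a::zero \<Rightarrow> 'b::zero) \<Rightarrow> 'a fls \<Rightarrow> 'b fls" where
  "fls_map h F = Abs_fls (\<lambda>n. h (fls_nth F n))"

lemma fls_map_nth: "h 0 = 0 \<Longrightarrow> fls_nth (fls_map h F) n = h (fls_nth F n)"
  unfolding fls_map_def by (rule nth_Abs_fls_lower_bound[of "fls_subdegree F"]) auto

lemma fls_map_fps_to_fls: "h 0 = 0 \<Longrightarrow> fls_map h (fps_to_fls f) = fps_to_fls (fps_map h f)"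
  by (intro fls_eqI) (simp add: fls_map_nth)

lemma fls_times_nth_lower_bounds:
  fixes f g :: "'a::semiring_0 fls"
  assumes "df \<le> fls_subdegree f" "dg \<le> fls_subdegree g"
  shows "fls_nth (f * g) n = (\<Sum>i=df..n - dg. fls_nth f i * fls_nth g (n - i))"
  unfolding fls_times_nth(2)
  by (rule sum.mono_neutral_left) (use assms in \<open>auto simp: not_le\<close>)

lemma fls_subdegree_fls_map_ge:
  assumes "h 0 = 0"
  shows "min (fls_subdegree F) 0 \<le> fls_subdegree (fls_map h F)"
proof (cases "fls_map h F = 0")
  case False
  thus ?thesis
    by (intro fls_subdegree_geI) (auto simp: fls_map_nth assms)
qed simp

lemma comm_ring_hom_fls_map:
  assumes "comm_ring_hom h"
  shows "comm_ring_hom (fls_map h)"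
proof -
  interpret comm_ring_hom h by fact
  show ?thesis
  proof
    fix F G :: "'a fls"
    show "fls_map h (F + G) = fls_map h F + fls_map h G"
      by (intro fls_eqI) (simp add: fls_map_nth hom_zero hom_add)
    show "fls_map h 1 = 1"
      by (intro fls_eqI) (simp add: fls_map_nth hom_zero hom_one)
    show "fls_map h (F * G) = fls_map h F * fls_map h G"
      using fls_subdegree_fls_map_ge[of h, OF hom_zero, of F]
        fls_subdegree_fls_map_ge[of h, OF hom_zero, of G]
      by (intro fls_eqI)
        (simp add: fls_map_nth hom_zero hom_sum hom_mult
          fls_times_nth_lower_bounds[of "min (fls_subdegree F) 0" _ "min (fls_subdegree G) 0"])
  qed
qed

section \<open>Laurent series without polar part\<close>

definition fls_has_value :: "'a::zero fls \<Rightarrow> 'a \<Rightarrow> bool" where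
  "fls_has_value F c \<longleftrightarrow> (\<forall>n<0. fls_nth F n = 0) \<and> fls_nth F 0 = c"

lemma fls_has_value_fps_to_fls: "fls_has_value (fps_to_fls f) (fps_nth f 0)"
  by (simp add: fls_has_value_def)

lemma fls_has_value_obtain_fps:
  assumes "fls_has_value F c"
  obtains f where "F = fps_to_fls f" "fps_nth f 0 = c"
proof
  show "F = fps_to_fls (fls_regpart F)"
    using assms by (intro fls_eqI) (auto simp: fls_has_value_def)
  show "fps_nth (fls_regpart F) 0 = c"
    using assms by (simp add: fls_has_value_def)
qed

lemma fls_has_value_diff:
  fixes F G :: "'a::group_add fls"
  shows "fls_has_value F c \<Longrightarrow> fls_has_value G d \<Longrightarrow> fls_has_value (F - G) (c - d)"
  by (simp add: fls_has_value_def)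

lemma fls_has_value_sum:
  assumes "\<And>x. x \<in> A \<Longrightarrow> fls_has_value (F x) (c x)"
  shows "fls_has_value (\<Sum>x\<in>A. F x) (\<Sum>x\<in>A. c x)"
  using assms by (simp add: fls_has_value_def fls_nth_sum)

lemma fls_has_value_mult:
  fixes F G :: "'a::comm_ring_1 fls"
  assumes "fls_has_value F c" "fls_has_value G d"
  shows "fls_has_value (F * G) (c * d)"
proof -
  obtain f g where "F = fps_to_fls f" "fps_nth f 0 = c" "G = fps_to_fls g" "fps_nth g 0 = d"
    using assms by (metis fls_has_value_obtain_fps)
  thus ?thesis
    using fls_has_value_fps_to_fls[of "f * g"] by (simp add: fls_times_fps_to_fls)
qed

lemma fls_has_value_divide:
  fixes F G :: "'a::field fls"
  assumes "fls_has_value F c" "fls_has_value G d" "d \<noteq> 0"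
  shows "fls_has_value (F / G) (c / d)"
proof -
  obtain f g where f: "F = fps_to_fls f" "fps_nth f 0 = c" and g: "G = fps_to_fls g" "fps_nth g 0 = d"
    using assms by (metis fls_has_value_obtain_fps)
  have "F / G = fps_to_fls (f * inverse g)"
    using g assms(3)
    by (simp add: f(1) fls_times_fps_to_fls divide_inverse fls_inverse_fps_to_fls fps_unit_dvd)
  thus ?thesis
    using fls_has_value_fps_to_fls[of "f * inverse g"] f(2) g(2) by (simp add: divide_inverse)
qed

lemma fls_has_value_neg_one_power:
  "fls_has_value ((- 1) ^ n :: 'a::comm_ring_1 fls) ((- 1) ^ n)"
  by (cases "even n") (simp_all add: fls_has_value_def)

lemma fls_has_value_X_inv_times:
  fixes f :: "'a::comm_ring_1 fps"
  assumes "fps_nth f 0 = 0"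
  shows "fls_has_value (fls_X_inv * fps_to_fls f) (fps_nth f 1)"
  using assms by (auto simp: fls_has_value_def fls_X_inv_times_conv_shift)

lemma fls_has_value_of_nat_mult_cancel:
  fixes F :: "'a::{idom,ring_char_0} fls"
  assumes "n > 0" "fls_has_value (of_nat n * F) (of_nat n * c)"
  shows "fls_has_value F c"
  using assms by (simp add: fls_has_value_def)

lemma fls_has_value_map:
  "h 0 = 0 \<Longrightarrow> fls_has_value F c \<Longrightarrow> fls_has_value (fls_map h F) (h c)"
  by (simp add: fls_has_value_def fls_map_nth)

section \<open>Power sums and Newton's identities\<close>

definition newton_fps :: "(nat \<Rightarrow> 'a::comm_ring_1) \<Rightarrow> 'a fps" where
  "newton_fps p = Abs_fps (\<lambda>r. if r = 0 then 0 else (- 1) ^ (r - 1) * p r)"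

lemma newton_fps_nth: "fps_nth (newton_fps p) r = (if r = 0 then 0 else (- 1) ^ (r - 1) * p r)"
  by (simp add: newton_fps_def)

lemma newton_fps_add: "newton_fps p + newton_fps p' = newton_fps (\<lambda>r. p r + p' r)"
  by (intro fps_ext) (simp add: newton_fps_nth algebra_simps)

lemma newton_fps_mult_left: "newton_fps (\<lambda>r. c * p r) = fps_const c * newton_fps p"
  by (intro fps_ext) (simp add: newton_fps_nth mult_ac)

lemma newton_fps_compose_linear:
  "newton_fps p oo (fps_const c * fps_X) = newton_fps (\<lambda>r. c ^ r * p r)"
  by (intro fps_ext) (simp add: newton_fps_nth mult.left_commute)

text \<open>For \<open>E(y) = \<Prod>\<^sub>i (1 + x\<^sub>i y)\<close> this is the identity \<open>y E'(y) = \<Sum>\<^sub>r (-1)^(r-1) p\<^sub>r y^r E(y)\<close>,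
  where \<open>p\<^sub>r = \<Sum>\<^sub>i x\<^sub>i^r\<close>.\<close>

definition has_power_sums :: "'a::comm_ring_1 fps \<Rightarrow> (nat \<Rightarrow> 'a) \<Rightarrow> bool" where
  "has_power_sums E p \<longleftrightarrow> fps_XD E = newton_fps p * E"

lemma fps_XD_mult: "fps_XD (f * g) = fps_XD f * g + f * fps_XD (g :: 'a::comm_ring_1 fps)"
  by (simp add: fps_XD_def algebra_simps)

lemma has_power_sums_mult:
  assumes "has_power_sums E p" "has_power_sums F q"
  shows "has_power_sums (E * F) (\<lambda>r. p r + q r)"
  using assms by (simp add: has_power_sums_def fps_XD_mult algebra_simps flip: newton_fps_add)

lemma fps_XD_compose_linear:
  fixes f :: "'a::comm_ring_1 fps"
  shows "fps_XD (f oo (fps_const c * fps_X)) = fps_XD f oo (fps_const c * fps_X)"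
  by (intro fps_ext) (simp add: mult.left_commute)

lemma has_power_sums_compose_linear:
  fixes E :: "'a::idom fps"
  assumes "has_power_sums E p"
  shows "has_power_sums (E oo (fps_const c * fps_X)) (\<lambda>r. c ^ r * p r)"
  using assms
  by (simp add: has_power_sums_def fps_XD_compose_linear fps_compose_mult_distrib
      newton_fps_compose_linear)

lemma has_power_sums_map:
  assumes "comm_ring_hom h" "has_power_sums E p"
  shows "has_power_sums (fps_map h E) (\<lambda>r. h (p r))"
proof -
  interpret comm_ring_hom h by fact
  interpret fps_map: comm_ring_hom "fps_map h"
    by (rule comm_ring_hom_fps_map) fact
  have "fps_XD (fps_map h E) = fps_map h (newton_fps p * E)"
    using assms(2) unfolding has_power_sums_def
    by (intro fps_ext) (metis fps_XD_nth fps_map_nth hom_mult hom_of_nat)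
  moreover have "fps_map h (newton_fps p) = newton_fps (\<lambda>r. h (p r))"
    by (intro fps_ext) (simp add: newton_fps_nth hom_zero hom_mult hom_power hom_uminus hom_one)
  ultimately show ?thesis
    by (simp add: has_power_sums_def fps_map.hom_mult)
qed

lemma has_power_sums_one_plus: "has_power_sums (1 + fps_const c * fps_X) (\<lambda>r. c ^ r)"
  unfolding has_power_sums_def
proof (intro fps_ext)
  fix n
  let ?T = "newton_fps (\<lambda>r. c ^ r)"
  have T: "?T * (1 + fps_const c * fps_X) = ?T + fps_const c * (?T * fps_X)"
    by (simp add: distrib_left mult.left_commute)
  show "fps_nth (fps_XD (1 + fps_const c * fps_X)) n = fps_nth (?T * (1 + fps_const c * fps_X)) n"
    unfolding T by (cases n; cases "n - 1") (simp_all add: newton_fps_nth)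
qed

lemma has_power_sums_exp:
  fixes p :: "nat \<Rightarrow> 'a::field_char_0"
  shows "has_power_sums (fps_exp 1 oo newton_fps (\<lambda>r. p r / of_nat r)) p"
proof -
  let ?L = "newton_fps (\<lambda>r. p r / of_nat r)"
  have "fps_XD (fps_exp 1 oo ?L) = fps_XD ?L * (fps_exp 1 oo ?L)"
    by (simp add: fps_XD_def fps_compose_deriv newton_fps_nth)
  also have "fps_XD ?L = newton_fps p"
    by (intro fps_ext) (simp add: newton_fps_nth)
  finally show ?thesis
    by (simp add: has_power_sums_def)
qed

lemma has_power_sums_recurrence:
  assumes "has_power_sums E p"
  shows "of_nat k * fps_nth E k = (\<Sum>r\<in>{1..k}. (- 1) ^ (r - 1) * p r * fps_nth E (k - r))"
proof -
  have "of_nat k * fps_nth E k = (\<Sum>r=0..k. fps_nth (newton_fps p) r * fps_nth E (k - r))"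
    using assms by (simp add: has_power_sums_def fps_mult_nth flip: fps_XD_nth)
  also have "\<dots> = (\<Sum>r\<in>{1..k}. (- 1) ^ (r - 1) * p r * fps_nth E (k - r))"
    by (rule sum.mono_neutral_cong_right) (auto simp: newton_fps_nth)
  finally show ?thesis .
qed

lemma has_power_sums_fls_has_value:
  fixes E :: "'a::{idom,ring_char_0} fls fps"
  assumes E: "has_power_sums E p" "fls_has_value (fps_nth E 0) (fps_nth f 0)"
    and f: "has_power_sums f a"
    and p: "\<And>r. r > 0 \<Longrightarrow> fls_has_value (p r) (a r)"
  shows "fls_has_value (fps_nth E k) (fps_nth f k)"
proof (induction k rule: less_induct)
  case (less k)
  show ?case
  proof (cases "k = 0")
    case False
    have "fls_has_value (of_nat k * fps_nth E k) (of_nat k * fps_nth f k)"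
      unfolding has_power_sums_recurrence[OF E(1)] has_power_sums_recurrence[OF f]
      by (intro fls_has_value_sum fls_has_value_mult fls_has_value_neg_one_power p less.IH) auto
    thus ?thesis
      by (rule fls_has_value_of_nat_mult_cancel[rotated]) (use False in simp)
  qed (use E(2) in simp)
qed

section \<open>Symmetric functions of a geometric progression\<close>

definition geometric_psum :: "nat \<Rightarrow> 'a::field \<Rightarrow> 'a" where
  "geometric_psum r q = q ^ r / (1 - q ^ r)"

text \<open>For \<open>q\<close> of modulus less than one, \<^const>\<open>geometric_psum\<close> and the following are the power sums
  and the elementary symmetric functions of \<open>q, q\<^sup>2, q\<^sup>3, \<dots>\<close>.\<close>

definition geometric_esym :: "nat \<Rightarrow> 'a::field \<Rightarrow> 'a" where
  "geometric_esym k q = (\<Prod>j=1..k. geometric_psum j q)"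

lemma geometric_esym_0 [simp]: "geometric_esym 0 q = 1"
  by (simp add: geometric_esym_def)

lemma geometric_esym_Suc: "geometric_esym (Suc k) q = geometric_esym k q * geometric_psum (Suc k) q"
  by (simp add: geometric_esym_def)

lemma geometric_psum_rec: "q ^ r \<noteq> 1 \<Longrightarrow> geometric_psum r q = q ^ r + q ^ r * geometric_psum r q"
  by (simp add: geometric_psum_def field_simps)

lemma geometric_esym_Suc_rec:
  assumes "q ^ Suc k \<noteq> 1"
  shows "geometric_esym (Suc k) q = q ^ Suc k * geometric_esym (Suc k) q + q * (q ^ k * geometric_esym k q)"
proof -
  have "geometric_esym (Suc k) q
      = geometric_esym k q * (q ^ Suc k + q ^ Suc k * geometric_psum (Suc k) q)"
    by (simp only: geometric_esym_Suc flip: geometric_psum_rec[OF assms])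
  also have "\<dots> = q ^ Suc k * geometric_esym (Suc k) q + q * (q ^ k * geometric_esym k q)"
    by (simp add: geometric_esym_Suc algebra_simps)
  finally show ?thesis .
qed

lemma fps_scaling_fixpoint_eq_0:
  fixes f :: "'a::idom fps" and q :: 'a
  defines "c \<equiv> fps_const q * fps_X"
  assumes f: "f = (1 + c) * (f oo c)" and "fps_nth f 0 = 0" and q: "\<And>n. n > 0 \<Longrightarrow> q ^ n \<noteq> 1"
  shows "f = 0"
proof -
  have "fps_nth f n = 0" for n
  proof (induction n)
    case (Suc n)
    have "fps_nth f (Suc n) = fps_nth ((1 + c) * (f oo c)) (Suc n)"
      using f by simp
    also have "\<dots> = q ^ Suc n * fps_nth f (Suc n)"
      using Suc by (simp add: c_def distrib_right mult.assoc)
    finally show ?case using q[of "Suc n"] by simp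
  qed fact
  thus ?thesis by (intro fps_ext) simp
qed

lemma geometric_esym_fps_scaling:
  fixes q :: "'a::field"
  assumes "\<And>n. n > 0 \<Longrightarrow> q ^ n \<noteq> 1"
  defines "c \<equiv> fps_const q * fps_X" and "U \<equiv> Abs_fps (\<lambda>k. geometric_esym k q)"
  shows "U = (1 + c) * (U oo c)"
proof (intro fps_ext)
  fix n
  show "fps_nth U n = fps_nth ((1 + c) * (U oo c)) n"
  proof (cases n)
    case (Suc k)
    thus ?thesis using geometric_esym_Suc_rec[of q k] assms(1)[of "Suc k"]
      by (simp add: U_def c_def distrib_right mult.assoc)
  qed (simp add: U_def c_def distrib_right mult.assoc)
qed

text \<open>Both sides of \<open>y U'(y) = S(y) U(y)\<close> transform in the same way under \<open>y \<mapsto> q y\<close>, because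
  \<open>U(y) = (1 + q y) U(q y)\<close>, and this determines their difference.\<close>

lemma has_power_sums_geometric_esym:
  fixes q :: "'a::field"
  assumes q: "\<And>n. n > 0 \<Longrightarrow> q ^ n \<noteq> 1"
  shows "has_power_sums (Abs_fps (\<lambda>k. geometric_esym k q)) (\<lambda>r. geometric_psum r q)"
proof -
  define c where "c = fps_const q * fps_X"
  define U where "U = Abs_fps (\<lambda>k. geometric_esym k q)"
  define S where "S = newton_fps (\<lambda>r. geometric_psum r q)"
  define T where "T = newton_fps (\<lambda>r. q ^ r)"
  have XD_c: "fps_XD (1 + c) = T * (1 + c)"
    using has_power_sums_one_plus[of q] by (simp add: has_power_sums_def c_def T_def)
  have U: "U = (1 + c) * (U oo c)"
    unfolding U_def c_def using q by (rule geometric_esym_fps_scaling)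
  have S: "S = T + (S oo c)"
    unfolding S_def T_def c_def newton_fps_compose_linear newton_fps_add
    using geometric_psum_rec[OF q] by (intro fps_ext) (simp add: newton_fps_nth)
  have "fps_XD U = fps_XD ((1 + c) * (U oo c))"
    using U by (rule arg_cong)
  also have "\<dots> = T * (1 + c) * (U oo c) + (1 + c) * (fps_XD U oo c)"
    by (simp only: fps_XD_mult XD_c) (simp add: c_def fps_XD_compose_linear)
  finally have XD_U: "fps_XD U = T * (1 + c) * (U oo c) + (1 + c) * (fps_XD U oo c)" .
  have "S * U = (T + (S oo c)) * ((1 + c) * (U oo c))"
    using S U by simp
  also have "\<dots> = T * (1 + c) * (U oo c) + (1 + c) * ((S oo c) * (U oo c))"
    by (simp add: algebra_simps)
  finally have "fps_XD U - S * U = (1 + c) * ((fps_XD U oo c) - (S oo c) * (U oo c))"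
    using XD_U by (metis add_diff_cancel_left right_diff_distrib)
  also have "\<dots> = (1 + c) * ((fps_XD U - S * U) oo c)"
    by (simp add: fps_compose_sub_distrib fps_compose_mult_distrib c_def)
  finally have "fps_XD U - S * U = 0"
    unfolding c_def by (rule fps_scaling_fixpoint_eq_0) (use q in \<open>auto simp: S_def newton_fps_nth\<close>)
  thus ?thesis
    by (simp add: has_power_sums_def U_def S_def)
qed

section \<open>The renormalized trailing zeros\<close>

abbreviation expz :: "'a::field_char_0 fls" where
  "expz \<equiv> fps_to_fls (fps_exp 1)"

lemma expz_power: "expz ^ r = fps_to_fls (fps_exp (of_nat r))"
  by (simp flip: fps_to_fls_power add: fps_exp_power_mult)

lemma expz_power_neq_1:
  assumes "r > 0"
  shows "(expz :: 'a::field_char_0 fls) ^ r \<noteq> 1"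
proof
  assume "(expz :: 'a fls) ^ r = 1"
  hence "fps_nth (fps_exp (of_nat r) :: 'a fps) 1 = fps_nth 1 1"
    by (simp add: expz_power)
  thus False using assms by simp
qed

definition pole_term :: "nat \<Rightarrow> 'a::field_char_0 fls" where
  "pole_term r = fls_const (1 / of_nat r) * fls_X_inv"

lemma fls_nth_pole_term_times: "fls_nth (pole_term r * F) n = fls_nth F (n + 1) / of_nat r"
  by (simp add: pole_term_def mult.assoc fls_X_inv_times_conv_shift(1))

lemma fls_has_value_geometric_psum_expz:
  assumes "r > 0"
  shows "fls_has_value (geometric_psum r expz + pole_term r) (- 1 / 2 :: 'a::field_char_0)"
proof -
  define e where "e = (fps_exp (of_nat r) :: 'a fps)"
  define d where "d = fps_shift 1 (1 - e)"
  define g where "g = fps_shift 1 (fps_const (of_nat r) * e + d)"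
  have d_nth: "fps_nth d 0 = - of_nat r" "fps_nth d 1 = - (of_nat r)\<^sup>2 / 2"
    by (simp_all add: d_def e_def power2_eq_square numeral_2_eq_2)
  have "1 - e = fps_X * d"
    by (intro fps_ext) (auto simp: d_def e_def)
  hence d: "1 - expz ^ r = fls_X * fps_to_fls d"
    by (simp add: expz_power flip: e_def fls_times_fps_to_fls fps_one_to_fls fps_to_fls_minus fps_X_to_fls)
  have "fps_const (of_nat r) * e + d = fps_X * g"
    by (intro fps_ext) (auto simp: g_def d_nth e_def)
  hence g: "of_nat r * expz ^ r + fps_to_fls d = fls_X * fps_to_fls g"
    by (simp add: expz_power fls_of_nat flip: e_def fls_times_fps_to_fls fps_to_fls_plus fps_X_to_fls
        fps_const_to_fls)
  have d_neq_0: "fps_to_fls d \<noteq> 0"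
    using d_nth(1) assms by auto
  have "pole_term r = 1 / (of_nat r * fls_X :: 'a fls)"
    by (simp add: pole_term_def fls_of_nat divide_inverse fls_inverse_X fls_inverse_const mult.commute)
  hence "geometric_psum r expz + pole_term r
      = (of_nat r * expz ^ r + fps_to_fls d) / (of_nat r * fls_X * fps_to_fls d)"
    using d_neq_0 assms by (simp add: geometric_psum_def d add_divide_distrib)
  also have "\<dots> = fps_to_fls g / fps_to_fls (of_nat r * d)"
    unfolding g by (simp add: fls_times_fps_to_fls fps_to_fls_of_nat)
  also have "fls_has_value \<dots> (fps_nth g 0 / fps_nth (of_nat r * d) 0)"
    by (intro fls_has_value_divide fls_has_value_fps_to_fls) (use d_nth(1) assms in simp)
  also have "fps_nth g 0 / fps_nth (of_nat r * d) 0 = - 1 / 2"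
    using assms by (simp add: g_def d_nth[unfolded One_nat_def] e_def power2_eq_square field_simps)
  finally show ?thesis .
qed

abbreviation const_coeffs :: "rat fls \<Rightarrow> rat poly fls" where
  "const_coeffs \<equiv> fls_map (\<lambda>c. [:c:])"

interpretation const_coeffs: comm_ring_hom const_coeffs
  by (rule comm_ring_hom_fls_map[OF comm_ring_hom_const_poly])

definition fps_exp_poly :: "'a::field_char_0 poly \<Rightarrow> 'a poly fps" where
  "fps_exp_poly p = Abs_fps (\<lambda>n. smult (1 / fact n) (p ^ n))"

lemma fps_exp_poly_nth_0: "fps_nth (fps_exp_poly p) 0 = 1"
  by (simp add: fps_exp_poly_def)

lemma fps_exp_poly_0: "fps_exp_poly 0 = 1"
  by (intro fps_ext) (simp add: fps_exp_poly_def power_0_left)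

lemma fps_exp_poly_power_nth_1: "fps_nth (fps_exp_poly p ^ r) 1 = of_nat r * p"
proof (induction r)
  case (Suc r)
  have "fps_nth (fps_exp_poly p ^ r) 0 = 1"
    by (simp add: fps_exp_poly_nth_0 fps_nth_power_0)
  with Suc show ?case
    by (simp add: fps_mult_nth fps_exp_poly_nth_0) (simp add: fps_exp_poly_def algebra_simps)
qed simp

lemma fls_has_value_shifted_power_sum:
  assumes "r > 0"
  shows "fls_has_value (fps_to_fls (fps_exp_poly p) ^ r * const_coeffs (geometric_psum r expz)
      + const_coeffs (pole_term r)) (- p - [:1 / 2:])"
proof -
  define E where "E = fps_exp_poly p ^ r"
  have E: "fls_has_value (fps_to_fls E) 1"
    using fls_has_value_fps_to_fls[of E] by (simp add: E_def fps_nth_power_0 fps_exp_poly_nth_0)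
  define F where "F = fps_const [:1 / of_nat r:] * (E - 1)"
  have F: "fps_nth F 0 = 0" "fps_nth F 1 = p"
    using assms
    by (simp_all add: F_def E_def fps_nth_power_0 fps_exp_poly_nth_0 fps_exp_poly_power_nth_1 of_nat_poly
        del: One_nat_def)
  have pole: "const_coeffs (pole_term r) = fls_const [:1 / of_nat r:] * fls_X_inv"
    by (intro fls_eqI) (simp add: fls_map_nth pole_term_def)
  have "fls_has_value (fps_to_fls E * const_coeffs (geometric_psum r expz + pole_term r)
      - fls_X_inv * fps_to_fls F) (1 * [:- 1 / 2:] - p)"
    using E F fls_has_value_X_inv_times[OF F(1)] assms
    by (intro fls_has_value_diff fls_has_value_mult fls_has_value_map
        fls_has_value_geometric_psum_expz) auto
  also have "fls_X_inv * fps_to_fls F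
      = fps_to_fls E * const_coeffs (pole_term r) - const_coeffs (pole_term r)"
    by (simp add: F_def pole fls_times_fps_to_fls fps_const_to_fls algebra_simps)
  also have "1 * [:- 1 / 2:] - p = - p - [:1 / 2:]"
    by simp
  finally show ?thesis
    by (simp add: E_def fps_to_fls_power const_coeffs.hom_add distrib_left)
qed

definition counterterm_fps :: "rat fls fps" where
  "counterterm_fps = fps_exp 1 oo newton_fps (\<lambda>r. pole_term r / of_nat r)"

lemma has_power_sums_counterterm_fps: "has_power_sums counterterm_fps pole_term"
  unfolding counterterm_fps_def by (rule has_power_sums_exp)

lemma counterterm_fps_nth_0: "fps_nth counterterm_fps 0 = 1"
  by (simp add: counterterm_fps_def)

lemma counterterm_fps_polar:
  "(if k = 0 then 1 else 0) \<le> n \<Longrightarrow> fls_nth (fps_nth counterterm_fps k) n = 0"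
proof (induction k arbitrary: n rule: less_induct)
  case (less k)
  show ?case
  proof (cases "k = 0")
    case False
    have "fls_nth ((- 1) ^ (r - 1) * pole_term r * fps_nth counterterm_fps (k - r)) n = 0"
      if "r \<in> {1..k}" for r
      using that less.IH[of "k - r" "n + 1"] less.prems False
      by (cases "even (r - 1)")
        (auto simp: mult.assoc fls_nth_pole_term_times split: if_splits)
    hence "fls_nth (of_nat k * fps_nth counterterm_fps k) n = 0"
      unfolding has_power_sums_recurrence[OF has_power_sums_counterterm_fps] fls_nth_sum
      by (rule sum.neutral[OF ballI])
    thus ?thesis using False by simp
  qed (use less.prems in \<open>simp add: counterterm_fps_nth_0\<close>)
qed

definition binomial_poly :: "'a::field_char_0 poly \<Rightarrow> nat \<Rightarrow> 'a poly" where
  "binomial_poly p k = smult (1 / fact k) (\<Prod>j<k. p - of_nat j)"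

lemma binomial_poly_0 [simp]: "binomial_poly p 0 = 1"
  by (simp add: binomial_poly_def)

lemma binomial_poly_Suc: "of_nat (Suc k) * binomial_poly p (Suc k) = (p - of_nat k) * binomial_poly p k"
  by (simp add: binomial_poly_def of_nat_poly mult.commute flip: of_nat_Suc)

lemma poly_binomial_poly: "poly (binomial_poly p k) x = poly p x gchoose k"
  by (simp add: binomial_poly_def poly_prod gbinomial_prod_rev atLeast0LessThan)

lemma degree_binomial_poly:
  assumes "degree p \<le> 1"
  shows "degree (binomial_poly p k) \<le> k"
proof -
  have "degree (\<Prod>j<k. p - of_nat j) \<le> (\<Sum>j<k. degree (p - of_nat j))"
    using degree_prod_sum_le[of "{..<k}" "\<lambda>j. p - of_nat j"] by (simp add: o_def)
  also have "\<dots> \<le> (\<Sum>j<k. 1)"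
    using assms by (intro sum_mono degree_diff_le) auto
  finally show ?thesis by (simp add: binomial_poly_def)
qed

text \<open>That is, \<open>(1 + y) powr p\<close> behaves like a product over \<open>p\<close> variables equal to one.\<close>

lemma has_power_sums_binomial: "has_power_sums (Abs_fps (binomial_poly p)) (\<lambda>_. p)"
proof -
  let ?B = "Abs_fps (binomial_poly p)"
  have one_plus_X_neq_0: "1 + fps_X \<noteq> (0 :: 'a poly fps)"
    by (metis add_cancel_left_right fps_X_nth fps_add_nth fps_one_nth fps_zero_nth zero_neq_one)
  have "(1 + fps_X) * fps_XD ?B = fps_const p * fps_X * ?B"
  proof (intro fps_ext)
    fix n
    show "fps_nth ((1 + fps_X) * fps_XD ?B) n = fps_nth (fps_const p * fps_X * ?B) n"
    proof (cases n)
      case (Suc k)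
      show ?thesis
        using binomial_poly_Suc[of k p] by (simp add: Suc distrib_right mult.assoc algebra_simps)
    qed (simp add: mult.assoc)
  qed
  also have "fps_const p * fps_X = (1 + fps_X) * newton_fps (\<lambda>_. p)"
    using newton_fps_mult_left[of p "\<lambda>_. 1"] has_power_sums_one_plus[of "1 :: 'a poly"]
    by (simp add: has_power_sums_def fps_XD_def mult_ac)
  finally have "fps_XD ?B = newton_fps (\<lambda>_. p) * ?B"
    unfolding mult.assoc by (rule mult_left_cancel[OF one_plus_X_neq_0, THEN iffD1])
  thus ?thesis by (simp add: has_power_sums_def)
qed

lemma fls_has_value_renormalized_zeros:
  "fls_has_value
    (\<Sum>l\<le>k. fps_to_fls (fps_exp_poly p) ^ l * const_coeffs (geometric_esym l expz)
      * const_coeffs (fps_nth counterterm_fps (k - l)))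
    (binomial_poly (- p - [:1 / 2:]) k)"
proof -
  define e where "e = fps_to_fls (fps_exp_poly p)"
  define U where "U = fps_map const_coeffs (Abs_fps (\<lambda>l. geometric_esym l expz))"
  define C where "C = fps_map const_coeffs counterterm_fps"
  define R where "R = (U oo (fps_const e * fps_X)) * C"
  have "has_power_sums U (\<lambda>r. const_coeffs (geometric_psum r expz))"
    unfolding U_def
    by (intro has_power_sums_map has_power_sums_geometric_esym expz_power_neq_1)
      (rule const_coeffs.comm_ring_hom_axioms)
  moreover have "has_power_sums C (\<lambda>r. const_coeffs (pole_term r))"
    unfolding C_def
    by (rule has_power_sums_map[OF const_coeffs.comm_ring_hom_axioms has_power_sums_counterterm_fps])
  ultimately have "has_power_sums R
      (\<lambda>r. e ^ r * const_coeffs (geometric_psum r expz) + const_coeffs (pole_term r))"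
    unfolding R_def by (intro has_power_sums_mult has_power_sums_compose_linear)
  moreover have "fls_has_value (fps_nth R 0) (fps_nth (Abs_fps (binomial_poly (- p - [:1 / 2:]))) 0)"
    by (simp add: R_def U_def C_def counterterm_fps_nth_0 const_coeffs.hom_one fls_has_value_def)
  ultimately have "fls_has_value (fps_nth R k) (fps_nth (Abs_fps (binomial_poly (- p - [:1 / 2:]))) k)"
    using has_power_sums_binomial[of "- p - [:1 / 2:]"] fls_has_value_shifted_power_sum[of _ p, folded e_def]
    by (rule has_power_sums_fls_has_value)
  thus ?thesis
    by (simp add: R_def U_def C_def fps_mult_nth e_def atLeast0AtMost)
qed

section \<open>Strictly increasing lists\<close>

definition strict_lists :: "'a::linorder set \<Rightarrow> nat \<Rightarrow> 'a list set" where
  "strict_lists A k = {xs. length xs = k \<and> sorted_wrt (<) xs \<and> set xs \<subseteq> A}"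

lemma strict_lists_0 [simp]: "strict_lists A 0 = {[]}"
  by (auto simp: strict_lists_def)

lemma strict_lists_empty_Suc [simp]: "strict_lists {} (Suc k) = {}"
  by (auto simp: strict_lists_def)

lemma finite_strict_lists: "finite A \<Longrightarrow> finite (strict_lists A k)"
  by (rule finite_subset[OF _ finite_lists_length_eq[of A k]]) (auto simp: strict_lists_def)

lemma strict_lists_insert_least:
  assumes "\<forall>y\<in>A. x < y"
  shows "strict_lists (insert x A) (Suc k) = Cons x ` strict_lists A k \<union> strict_lists A (Suc k)"
proof (intro equalityI subsetI)
  fix xs assume "xs \<in> strict_lists (insert x A) (Suc k)"
  then obtain y ys where y: "xs = y # ys" "y = x \<or> y \<in> A" "set ys \<subseteq> insert x A"
    "\<forall>z\<in>set ys. y < z" "sorted_wrt (<) ys" "length ys = k"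
    by (cases xs) (auto simp: strict_lists_def)
  moreover have "x \<notin> set ys"
    using y(2,4) assms by (meson order_less_asym order_less_irrefl)
  ultimately show "xs \<in> Cons x ` strict_lists A k \<union> strict_lists A (Suc k)"
    by (auto simp: strict_lists_def)
qed (use assms in \<open>auto simp: strict_lists_def subset_iff\<close>)

lemma card_strict_lists:
  assumes "finite A"
  shows "card (strict_lists A k) = card A choose k"
  using assms
proof (induction A arbitrary: k rule: finite_linorder_min_induct)
  case empty
  show ?case by (cases k) simp_all
next
  case (insert x A)
  show ?case
  proof (cases k)
    case (Suc j)
    have "Cons x ` strict_lists A j \<inter> strict_lists A (Suc j) = {}"
      using insert.hyps(2) by (auto simp: strict_lists_def)
    moreover have "x \<notin> A"
      using insert.hyps(2) by blast
    ultimately show ?thesis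
      using insert
      by (simp add: Suc strict_lists_insert_least card_Un_disjoint finite_strict_lists card_image)
  qed simp
qed

lemma has_sum_prod_list:
  fixes f :: "'a \<Rightarrow> real"
  assumes f: "(f has_sum s) A" and nonneg: "\<And>x. x \<in> A \<Longrightarrow> 0 \<le> f x"
  shows "((\<lambda>xs. \<Prod>x\<leftarrow>xs. f x) has_sum s ^ k) {xs. set xs \<subseteq> A \<and> length xs = k}"
proof (induction k)
  case 0
  have "{xs. set xs \<subseteq> A \<and> length xs = 0} = {[]}" by auto
  thus ?case by (simp add: has_sum_finiteI)
next
  case (Suc k)
  let ?L = "\<lambda>k. {xs. set xs \<subseteq> A \<and> length xs = k}"
  let ?g = "\<lambda>(x, xs). f x * (\<Prod>y\<leftarrow>xs. f y)"
  have inner: "((\<lambda>xs. ?g (x, xs)) has_sum (f x * s ^ k)) (?L k)" for x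
    using has_sum_cmult_right[OF Suc] by simp
  have outer: "((\<lambda>x. f x * s ^ k) has_sum s ^ Suc k) A"
    using has_sum_cmult_left[OF f] by simp
  have "?g summable_on A \<times> ?L k"
    by (rule summable_on_SigmaI[OF inner has_sum_imp_summable[OF outer]])
      (auto intro!: mult_nonneg_nonneg prod_list_nonneg nonneg)
  with inner outer have "(?g has_sum s ^ Suc k) (A \<times> ?L k)"
    by (rule has_sum_SigmaI)
  also have "?this \<longleftrightarrow> ?case"
    by (rule has_sum_reindex_bij_witness[of _ "\<lambda>xs. (hd xs, tl xs)" "\<lambda>(x, xs). x # xs"])
      (auto simp: length_Suc_conv)
  finally show ?case .
qed

lemma has_sum_geometric_greaterThan:
  fixes q :: "'a::{real_normed_field, banach}"
  assumes "norm q < 1"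
  shows "((\<lambda>x. q ^ x) has_sum (q ^ Suc n / (1 - q))) {n<..}"
proof -
  have "((\<lambda>x. q ^ n * q ^ x) has_sum (q ^ n * (q / (1 - q)))) {1..}"
    using assms by (intro has_sum_cmult_right has_sum_geometric_from_1)
  also have "?this \<longleftrightarrow> ((\<lambda>x. q ^ x) has_sum (q ^ n * (q / (1 - q)))) {n<..}"
    by (rule has_sum_reindex_bij_witness[of _ "\<lambda>x. x - n" "\<lambda>x. n + x"]) (auto simp: power_add)
  finally show ?thesis by (simp add: mult.commute)
qed

lemma summable_power_sum_list:
  fixes q :: "'a::{real_normed_field, banach}"
  assumes "norm q < 1"
  shows "(\<lambda>xs. q ^ sum_list xs) summable_on {xs. set xs \<subseteq> {1..} \<and> length xs = k}"
proof -
  have "((\<lambda>xs. \<Prod>x\<leftarrow>xs. norm q ^ x) has_sum (norm q / (1 - norm q)) ^ k)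
      {xs. set xs \<subseteq> {1..} \<and> length xs = k}"
    using assms by (intro has_sum_prod_list has_sum_geometric_from_1) auto
  moreover have "(\<Prod>x\<leftarrow>xs. norm q ^ x) = norm (q ^ sum_list xs)" for xs
    by (induction xs) (simp_all add: norm_mult norm_power power_add)
  ultimately show ?thesis
    by (intro abs_summable_summable[of "\<lambda>xs. q ^ sum_list xs"]) (simp add: has_sum_imp_summable)
qed

lemma has_sum_power_sum_list:
  fixes q :: "'a::{real_normed_field, banach}"
  assumes q: "norm q < 1"
  shows "((\<lambda>xs. q ^ sum_list xs) has_sum (q ^ (k * n) * geometric_esym k q)) (strict_lists {n<..} k)"
proof (induction k arbitrary: n)
  case 0
  show ?case by (simp add: has_sum_finiteI)
next
  case (Suc k)
  let ?f = "\<lambda>(x, xs). q ^ (x + sum_list xs)" and ?S = "Sigma {n<..} (\<lambda>x. strict_lists {x<..} k)"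
  have reindex: "bij_betw (\<lambda>(x, xs). x # xs) ?S (strict_lists {n<..} (Suc k))"
    by (rule bij_betwI[of _ _ _ "\<lambda>xs. (hd xs, tl xs)"])
      (force simp: strict_lists_def length_Suc_conv)+
  have inner: "((\<lambda>xs. ?f (x, xs)) has_sum ((q ^ Suc k) ^ x * geometric_esym k q)) (strict_lists {x<..} k)"
    for x
    using has_sum_cmult_right[OF Suc[of x], of "q ^ x"]
    by (simp add: power_add power_mult power_mult_distrib mult.assoc)
  have "norm (q ^ Suc k) < 1"
    unfolding norm_power using q by (intro power_less_one_iff[THEN iffD2]) auto
  from has_sum_cmult_left[OF has_sum_geometric_greaterThan[OF this, of n], of "geometric_esym k q"]
  have "((\<lambda>x. (q ^ Suc k) ^ x * geometric_esym k q) has_sum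
      ((q ^ Suc k) ^ Suc n / (1 - q ^ Suc k) * geometric_esym k q)) {n<..}" .
  also have "(q ^ Suc k) ^ Suc n / (1 - q ^ Suc k) * geometric_esym k q
      = q ^ (Suc k * n) * geometric_esym (Suc k) q"
    unfolding power_mult power_Suc2[of "q ^ Suc k" n] geometric_esym_Suc geometric_psum_def
    by (simp only: mult_ac times_divide_eq_left times_divide_eq_right)
  finally have outer: "((\<lambda>x. (q ^ Suc k) ^ x * geometric_esym k q) has_sum
      (q ^ (Suc k * n) * geometric_esym (Suc k) q)) {n<..}" .
  have "(\<lambda>xs. q ^ sum_list xs) summable_on strict_lists {n<..} (Suc k)"
    by (rule summable_on_subset_banach[OF summable_power_sum_list[OF q]]) (auto simp: strict_lists_def)
  hence "?f summable_on ?S"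
    unfolding summable_on_reindex_bij_betw[OF reindex, symmetric] by (simp add: case_prod_unfold)
  with inner outer have "(?f has_sum (q ^ (Suc k * n) * geometric_esym (Suc k) q)) ?S"
    by (rule has_sum_SigmaI)
  thus ?case
    unfolding has_sum_reindex_bij_betw[OF reindex, symmetric] by (simp add: case_prod_unfold)
qed

section \<open>Words with bottom row one\<close>

definition over_ones :: "nat list \<Rightarrow> (nat \<times> nat) list" where
  "over_ones a = map (\<lambda>x. (x, 1)) a"

definition index_lists :: "nat set \<Rightarrow> nat list \<Rightarrow> xmono \<Rightarrow> nat list set" where
  "index_lists A a m = {i \<in> strict_lists A (length a). mono_of i a = m}"

lemma length_over_ones [simp]: "length (over_ones a) = length a"
  by (simp add: over_ones_def)

lemma over_ones_eq_Nil_iff [simp]: "over_ones a = [] \<longleftrightarrow> a = []"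
  by (simp add: over_ones_def)

lemma map_fst_over_ones [simp]: "map fst (over_ones a) = a"
  by (simp add: over_ones_def o_def)

lemma idx_set_over_ones: "idx_set (over_ones a) m = index_lists {0<..} a m"
  by (auto simp: idx_set_def index_lists_def strict_lists_def over_ones_def o_def)

lemma mono_of_Nil [simp]: "mono_of [] a = 0"
  by (simp add: mono_of_def)

lemma mono_of_Cons [simp]: "mono_of (n # i) (x # a) = Poly_Mapping.single n x + mono_of i a"
  by (simp add: mono_of_def sum.lessThan_Suc_shift del: sum.lessThan_Suc)

lemma mono_of_append:
  "length i = length a \<Longrightarrow> mono_of (i @ j) (a @ b) = mono_of i a + mono_of j b"
  by (induction i a rule: list_induct2) (simp_all add: add.assoc)

lemma mono_of_replicate_0 [simp]: "length j = k \<Longrightarrow> mono_of j (replicate k 0) = 0"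
  by (simp add: mono_of_def)

definition last_index :: "nat list \<Rightarrow> nat" where
  "last_index i = last (0 # i)"

lemma index_lists_Nil: "index_lists A [] m = (if m = 0 then {[]} else {})"
  by (auto simp: index_lists_def)

lemma strict_sorted_le_last:
  fixes xs :: "'a::linorder list"
  assumes "sorted_wrt (<) xs" "x \<in> set xs"
  shows "x \<le> last xs"
  using assms by (induction xs) (auto intro: less_imp_le dest: last_in_set)

lemma strict_lists_append_iff:
  fixes i j :: "nat list"
  assumes "A \<subseteq> {0<..}" "length i = p"
  shows "i @ j \<in> strict_lists A (p + k)
    \<longleftrightarrow> i \<in> strict_lists A p \<and> j \<in> strict_lists (A \<inter> {last_index i<..}) k"
proof -
  have "(\<forall>x\<in>set i. \<forall>y\<in>set j. x < y) \<longleftrightarrow> (\<forall>y\<in>set j. last_index i < y)"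
    if "sorted_wrt (<) i" "set j \<subseteq> A"
  proof (cases "i = []")
    case True
    thus ?thesis using assms(1) that(2) by (auto simp: last_index_def)
  next
    case False
    thus ?thesis
      using strict_sorted_le_last[OF that(1)]
      by (metis last_ConsR last_in_set last_index_def le_less_trans)
  qed
  thus ?thesis
    using assms(2) by (auto simp: strict_lists_def sorted_wrt_append)
qed

lemma index_lists_append_zeros:
  assumes "A \<subseteq> {0<..}"
  shows "index_lists A (u @ replicate k 0) m
    = (\<lambda>(i, j). i @ j) ` Sigma (index_lists A u m) (\<lambda>i. strict_lists (A \<inter> {last_index i<..}) k)"
    (is "_ = _ ` ?S")
proof (intro equalityI subsetI)
  fix l assume l: "l \<in> index_lists A (u @ replicate k 0) m"
  obtain i j where ij: "l = i @ j" "length i = length u" "length j = k"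
    using l by (intro that[of "take (length u) l" "drop (length u) l"])
      (auto simp: index_lists_def strict_lists_def)
  hence "(i, j) \<in> ?S"
    using l strict_lists_append_iff[OF assms ij(2), of j k]
    by (auto simp: index_lists_def mono_of_append)
  thus "l \<in> (\<lambda>(i, j). i @ j) ` ?S"
    using ij by force
next
  fix l assume "l \<in> (\<lambda>(i, j). i @ j) ` ?S"
  then obtain i j where ij: "l = i @ j" "i \<in> index_lists A u m"
    "j \<in> strict_lists (A \<inter> {last_index i<..}) k"
    by auto
  hence "length i = length u" "length j = k"
    by (auto simp: index_lists_def strict_lists_def)
  thus "l \<in> index_lists A (u @ replicate k 0) m"
    using ij strict_lists_append_iff[OF assms, of i "length u" j k]
    by (auto simp: index_lists_def mono_of_append)
qed

lemma inj_on_append_index_lists: "inj_on (\<lambda>(i, j). i @ j) (Sigma (index_lists A u m) B)"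
  by (auto simp: inj_on_def index_lists_def strict_lists_def)

lemma index_lists_le_keys:
  assumes u: "no_trailing ((=) 0) u" and N: "Poly_Mapping.keys m \<subseteq> {..N}"
  shows "index_lists A u m = index_lists (A \<inter> {..N}) u m"
proof -
  have "set i \<subseteq> {..N}" if i: "i \<in> index_lists A u m" for i
  proof (cases "u = []")
    case True
    thus ?thesis using i by (simp add: index_lists_def)
  next
    case False
    then obtain v c where v: "u = v @ [c]" "c \<noteq> 0"
      using u by (cases u rule: rev_cases) auto
    have "length i = length v + 1"
      using i v by (simp add: index_lists_def strict_lists_def)
    then obtain j n where j: "i = j @ [n]" "length j = length v"
      by (cases i rule: rev_cases) auto
    hence "m = mono_of j v + Poly_Mapping.single n c"
      using i v mono_of_append[OF j(2), of "[n]" "[c]"] by (simp add: index_lists_def)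
    hence "n \<in> Poly_Mapping.keys m"
      using v(2) by (simp add: in_keys_iff lookup_add lookup_single)
    moreover have "x \<le> n" if "x \<in> set i" for x
      using i j(1) that strict_sorted_le_last[of i x] by (simp add: index_lists_def strict_lists_def)
    ultimately show ?thesis using N by fastforce
  qed
  thus ?thesis
    by (auto simp: index_lists_def strict_lists_def)
qed

lemma finite_index_lists:
  assumes "no_trailing ((=) 0) u"
  shows "finite (index_lists A u m)"
proof -
  obtain N where "Poly_Mapping.keys m \<subseteq> {..N}"
    using finite_nat_iff_bounded_le by (metis finite_keys)
  hence "index_lists A u m = index_lists (A \<inter> {..N}) u m"
    by (rule index_lists_le_keys[OF assms])
  also have "\<dots> \<subseteq> strict_lists {..N} (length u)"
    by (auto simp: index_lists_def strict_lists_def)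
  finally show ?thesis
    by (rule finite_subset) (simp add: finite_strict_lists)
qed

section \<open>The regularized series of words with bottom row one\<close>

lemma phi_fun_over_ones:
  "phi_fun (over_ones a) m t z = (\<Sum>\<^sub>\<infinity>i\<in>index_lists {0<..} a m.
      exp ((of_nat (sum_list i) + of_real t * of_nat (length a)) * z))"
  unfolding phi_fun_def idx_set_over_ones
proof (rule infsum_cong)
  fix i assume "i \<in> index_lists {0<..} a m"
  hence "length i = length a"
    by (simp add: index_lists_def strict_lists_def)
  hence "(\<Sum>l<length a. (of_nat (i ! l) + complex_of_real t) * of_nat (snd (over_ones a ! l)))
      = of_nat (sum_list i) + of_real t * of_nat (length a)"
    by (simp add: over_ones_def sum.distrib sum_list_sum_nth atLeast0LessThan)
  thus "exp (z * (\<Sum>l<length (over_ones a).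
          (of_nat (i ! l) + complex_of_real t) * of_nat (snd (over_ones a ! l))))
      = exp ((of_nat (sum_list i) + of_real t * of_nat (length a)) * z)"
    by (simp add: mult.commute)
qed

lemma phi_fun_append_zeros:
  assumes u: "no_trailing ((=) 0) u" and z: "Re z < 0"
  shows "phi_fun (over_ones (u @ replicate k 0)) m t z = (\<Sum>i\<in>index_lists {0<..} u m.
      exp ((of_nat (sum_list i) + of_real t * of_nat (length u)) * z)
      * exp ((of_nat (last_index i) + of_real t) * z) ^ k * geometric_esym k (exp z))"
proof -
  define g where "g = (\<lambda>l. exp ((of_nat (sum_list l) + of_real t * of_nat (length u + k)) * z))"
  define S where "S = (\<lambda>i. exp ((of_nat (sum_list i) + of_real t * of_nat (length u)) * z)
      * exp ((of_nat (last_index i) + of_real t) * z) ^ k * geometric_esym k (exp z))"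
  have "(g has_sum S i) ((@) i ` strict_lists {last_index i<..} k)" for i
  proof -
    have "((\<lambda>j. g i * exp z ^ sum_list j)
        has_sum (g i * (exp z ^ (k * last_index i) * geometric_esym k (exp z))))
        (strict_lists {last_index i<..} k)"
      using z by (intro has_sum_cmult_right has_sum_power_sum_list) simp
    also have "(\<lambda>j. g i * exp z ^ sum_list j) = g \<circ> (@) i"
      by (simp add: g_def fun_eq_iff flip: exp_add exp_of_nat_mult) (simp add: algebra_simps)
    also have "g i * (exp z ^ (k * last_index i) * geometric_esym k (exp z)) = S i"
      by (simp add: g_def S_def flip: exp_add exp_of_nat_mult mult.assoc) (simp add: algebra_simps)
    finally show ?thesis
      by (subst has_sum_reindex) (auto simp: inj_on_def o_def)
  qed
  hence "(g has_sum (\<Sum>i\<in>index_lists {0<..} u m. S i))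
      (\<Union>i\<in>index_lists {0<..} u m. (@) i ` strict_lists {last_index i<..} k)"
    using finite_index_lists[OF u]
    by (intro sum_has_sum) (auto simp: index_lists_def strict_lists_def)
  also have "(\<Union>i\<in>index_lists {0<..} u m. (@) i ` strict_lists {last_index i<..} k)
      = index_lists {0<..} (u @ replicate k 0) m"
  proof -
    have "{0<..} \<inter> {n<..} = {n<..}" for n :: nat by auto
    thus ?thesis by (auto simp: index_lists_append_zeros)
  qed
  finally show ?thesis
    by (simp add: phi_fun_over_ones g_def S_def infsumI)
qed

lemma laurent_left_unique:
  assumes "laurent_left F f" "laurent_left G f"
  shows "F = G"
proof -
  have diff: "(\<lambda>z. eval_fls F z - eval_fls G z) has_laurent_expansion F - G"
    using assms
    by (intro has_laurent_expansion_diff) (auto simp: laurent_left_def has_laurent_expansion_def)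
  have "eventually (\<lambda>z. eval_fls F z - eval_fls G z = 0) (at 0 within {z. Re z < 0})"
    using assms[unfolded laurent_left_def, THEN conjunct2] by eventually_elim simp
  moreover have "(0 :: complex) islimpt {z. Re z < 0}"
    unfolding islimpt_approachable
  proof (intro allI impI)
    fix e :: real assume "e > 0"
    thus "\<exists>x'\<in>{z. Re z < 0}. x' \<noteq> 0 \<and> dist x' 0 < e"
      by (intro bexI[of _ "complex_of_real (- e / 2)"]) auto
  qed
  ultimately have "frequently (\<lambda>z. eval_fls F z - eval_fls G z = 0) (at 0 within {z. Re z < 0})"
    by (intro eventually_frequently) (simp_all add: trivial_limit_within)
  hence "frequently (\<lambda>z. eval_fls F z - eval_fls G z = 0) (at 0)"
    unfolding frequently_def using filter_leD[OF at_le[OF subset_UNIV]] by blast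
  hence "F - G = 0"
    by (rule has_laurent_expansion_frequently_zero_iff[THEN iffD1, rotated]) (simp add: diff)
  thus ?thesis by simp
qed

lemma poly_eqI_infinite:
  fixes p q :: "'a::{comm_ring_1,ring_no_zero_divisors} poly"
  assumes "infinite {x. poly p x = poly q x}"
  shows "p = q"
proof -
  have "infinite {x. poly (p - q) x = 0}"
    using assms by simp
  hence "p - q = 0"
    using poly_roots_finite by blast
  thus ?thesis by simp
qed

definition evaluate_t :: "complex \<Rightarrow> rat poly \<Rightarrow> complex" where
  "evaluate_t x p = poly (map_poly of_rat p) x"

lemma comm_ring_hom_evaluate_t: "comm_ring_hom (evaluate_t x)"
proof -
  interpret comm_ring_hom "map_poly (of_rat :: rat \<Rightarrow> complex)"
    by (rule comm_ring_hom_map_poly[OF comm_ring_hom_of_rat])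
  show ?thesis
    by standard (simp_all add: evaluate_t_def hom_add hom_mult hom_one)
qed

interpretation evaluate_t: comm_ring_hom "evaluate_t x" for x
  by (rule comm_ring_hom_evaluate_t)

lemma evaluate_t_pCons [simp]: "evaluate_t x (pCons c p) = of_rat c + x * evaluate_t x p"
  by (simp add: evaluate_t_def map_poly_pCons)

lemma evaluate_t_0 [simp]: "evaluate_t x 0 = 0"
  by (simp add: evaluate_t_def)

lemma evaluate_t_smult [simp]: "evaluate_t x (smult c p) = of_rat c * evaluate_t x p"
  by (simp add: evaluate_t_def map_poly_smult of_rat_mult)

lemma evaluate_t_eq_imp_eq:
  assumes "\<And>t. t \<ge> 0 \<Longrightarrow> evaluate_t (complex_of_real t) p = evaluate_t (complex_of_real t) q"
  shows "p = q"
proof -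
  let ?h = "map_poly (of_rat :: rat \<Rightarrow> complex)"
  have "complex_of_real ` {0..} \<subseteq> {x. poly (?h p) x = poly (?h q) x}"
    using assms by (auto simp: evaluate_t_def)
  moreover have "infinite (complex_of_real ` {0..})"
    using infinite_Ici[of "0::real"] by (subst finite_image_iff) (auto simp: inj_on_def)
  ultimately have "infinite {x. poly (?h p) x = poly (?h q) x}"
    by (rule infinite_super)
  hence "?h p = ?h q"
    by (rule poly_eqI_infinite)
  thus ?thesis
    by (simp add: poly_eq_iff coeff_map_poly)
qed

lemma eval_t_eq_fls_map: "eval_t F t = fls_map (evaluate_t (of_real t)) F"
  by (simp add: eval_t_def fls_map_def evaluate_t_def)

interpretation eval_t: comm_ring_hom "\<lambda>F. eval_t F t" for t
  unfolding eval_t_eq_fls_map by (rule comm_ring_hom_fls_map[OF comm_ring_hom_evaluate_t])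

lemma phi_eqI:
  assumes "\<And>t. t \<ge> 0 \<Longrightarrow> laurent_left (eval_t F t) (phi_fun w m t)"
  shows "phi w m = F"
  unfolding phi_def
proof (rule the_equality)
  fix G assume G: "\<forall>t\<ge>0. laurent_left (eval_t G t) (phi_fun w m t)"
  show "G = F"
  proof (intro fls_eqI evaluate_t_eq_imp_eq)
    fix n and t :: real assume "t \<ge> 0"
    hence "eval_t G t = eval_t F t"
      using G assms laurent_left_unique by blast
    thus "evaluate_t (of_real t) (fls_nth G n) = evaluate_t (of_real t) (fls_nth F n)"
      by (metis eval_t_eq_fls_map evaluate_t_0 fls_map_nth)
  qed
qed (use assms in blast)

lemma of_rat_fact: "of_rat (fact n) = (fact n :: 'a::field_char_0)"
  by (metis of_nat_fact of_rat_of_nat_eq)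

lemma eval_t_fps_exp_poly:
  "eval_t (fps_to_fls (fps_exp_poly p)) t = fps_to_fls (fps_exp (evaluate_t (of_real t) p))"
  by (simp add: eval_t_eq_fls_map fls_map_fps_to_fls fps_map_def fps_exp_poly_def fps_exp_def
      evaluate_t.hom_power of_rat_divide of_rat_fact)

lemma eval_t_const_coeffs: "eval_t (const_coeffs F) t = fls_map of_rat F"
  by (intro fls_eqI) (simp add: eval_t_eq_fls_map fls_map_nth)

lemma fls_map_of_rat_geometric_esym:
  "fls_map of_rat (geometric_esym k expz) = (geometric_esym k expz :: 'a::field_char_0 fls)"
proof -
  let ?h = "fls_map (of_rat :: rat \<Rightarrow> 'a)"
  interpret comm_ring_hom ?h
    by (rule comm_ring_hom_fls_map[OF comm_ring_hom_of_rat])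
  have expz: "?h expz = expz"
    by (simp add: fls_map_fps_to_fls fps_map_def fps_exp_def of_rat_divide of_rat_fact)
  have "?h (geometric_psum j expz) = geometric_psum j expz" if "j > 0" for j
  proof -
    have "1 - expz ^ j \<noteq> (0 :: rat fls)"
      using expz_power_neq_1[OF that] by (metis right_minus_eq)
    thus ?thesis
      by (simp add: geometric_psum_def comm_ring_hom_divide[OF comm_ring_hom_axioms]
          hom_power hom_diff hom_one expz)
  qed
  thus ?thesis by (simp add: geometric_esym_def hom_prod)
qed

lemma has_laurent_expansion_geometric_esym:
  "(\<lambda>z. geometric_esym k (exp z)) has_laurent_expansion geometric_esym k expz"
  unfolding geometric_esym_def geometric_psum_def
  by (intro laurent_expansion_intros has_laurent_expansion_fps[OF has_fps_expansion_exp1])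

lemma laurent_leftI:
  assumes "g has_laurent_expansion F" "\<And>z. Re z < 0 \<Longrightarrow> f z = g z"
  shows "laurent_left F f"
proof -
  have "eventually (\<lambda>z. eval_fls F z = g z) (at 0 within {z. Re z < 0})"
    by (rule filter_leD[OF at_le[OF subset_UNIV]]) (use assms(1) in \<open>simp add: has_laurent_expansion_def\<close>)
  moreover have "eventually (\<lambda>z. Re z < 0) (at 0 within {z. Re z < 0})"
    by (simp add: eventually_at_filter)
  ultimately have "eventually (\<lambda>z. f z = eval_fls F z) (at 0 within {z. Re z < 0})"
    by eventually_elim (simp add: assms(2))
  thus ?thesis
    using assms(1) by (simp add: laurent_left_def has_laurent_expansion_def)
qed

lemma phi_append_zeros:
  assumes u: "no_trailing ((=) 0) u"
  shows "phi (over_ones (u @ replicate k 0)) m = (\<Sum>i\<in>index_lists {0<..} u m.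
      fps_to_fls (fps_exp_poly [:of_nat (sum_list i), of_nat (length u):])
      * fps_to_fls (fps_exp_poly [:of_nat (last_index i), 1:]) ^ k
      * const_coeffs (geometric_esym k expz))"
    (is "_ = ?F")
proof (rule phi_eqI, rule laurent_leftI[OF _ phi_fun_append_zeros[OF u]])
  fix t :: real
  let ?f = "\<lambda>z. \<Sum>i\<in>index_lists {0<..} u m.
      exp ((of_nat (sum_list i) + of_real t * of_nat (length u)) * z)
      * exp ((of_nat (last_index i) + of_real t) * z) ^ k * geometric_esym k (exp z)"
  have "eval_t ?F t = (\<Sum>i\<in>index_lists {0<..} u m.
      fps_to_fls (fps_exp (of_nat (sum_list i) + of_real t * of_nat (length u)))
      * fps_to_fls (fps_exp (of_nat (last_index i) + of_real t)) ^ k * geometric_esym k expz)"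
    by (simp add: eval_t.hom_sum eval_t.hom_mult eval_t.hom_power eval_t_fps_exp_poly
        eval_t_const_coeffs fls_map_of_rat_geometric_esym)
  also have "?f has_laurent_expansion \<dots>"
    by (intro laurent_expansion_intros has_laurent_expansion_geometric_esym
        has_laurent_expansion_fps[OF has_fps_expansion_exp])
  finally show "?f has_laurent_expansion eval_t ?F t" .
qed

section \<open>Uniqueness of the Birkhoff factorization\<close>

lemma finite_add_eq: "finite {(a, b). a + b = (m :: 'a \<Rightarrow>\<^sub>0 nat)}"
proof -
  let ?D = "{(a, b). a + b = m}" and ?B = "\<Union>x\<in>Poly_Mapping.keys m. {..Poly_Mapping.lookup m x}"
  define F where "F = {f. \<forall>x. (x \<in> Poly_Mapping.keys m \<longrightarrow> f x \<in> ?B) \<and>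
    (x \<notin> Poly_Mapping.keys m \<longrightarrow> f x = 0)}"
  have "Poly_Mapping.lookup a \<in> F" if "a + b = m" for a b
  proof -
    have le: "Poly_Mapping.lookup a x \<le> Poly_Mapping.lookup m x" for x
      using that by (auto simp: lookup_add)
    have "Poly_Mapping.lookup a x \<in> ?B" if "x \<in> Poly_Mapping.keys m" for x
      using that le by (intro UN_I atMost_iff[THEN iffD2])
    moreover have "Poly_Mapping.lookup a x = 0" if "x \<notin> Poly_Mapping.keys m" for x
      using that le[of x] by (simp add: in_keys_iff)
    ultimately show ?thesis
      by (simp only: F_def mem_Collect_eq) blast
  qed
  hence "(\<lambda>(a, b). Poly_Mapping.lookup a) ` ?D \<subseteq> F"
    by auto
  moreover have "finite F"
    unfolding F_def by (rule finite_set_of_finite_funs) auto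
  moreover have "inj_on (\<lambda>(a, b). Poly_Mapping.lookup a) ?D"
    by (auto simp: inj_on_def lookup_inject)
  ultimately show ?thesis
    by (meson finite_imageD finite_subset)
qed

lemma xmul_commute: "xmul f g = xmul g f"
  unfolding xmul_def
  by (intro ext sum.reindex_bij_witness[of _ prod.swap prod.swap]) (auto simp: add.commute mult.commute)

lemma xmul_const: "xmul f (\<lambda>m. if m = 0 then c else 0) m = f m * c"
proof -
  have "xmul f (\<lambda>m. if m = 0 then c else 0) m
      = (\<Sum>(a, b)\<in>{(m, 0 :: xmono)}. f a * (if b = 0 then c else 0))"
    unfolding xmul_def by (rule sum.mono_neutral_right) (use finite_add_eq in \<open>auto split: if_splits\<close>)
  thus ?thesis by simp
qed

lemma xmul_xone [simp]: "xmul f xone = f"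
  using xmul_const[of f 1] by (simp add: xone_def fun_eq_iff)

lemma xone_xmul [simp]: "xmul xone f = f"
  by (subst xmul_commute) simp

lemma xmul_zero [simp]: "xmul f (\<lambda>m. 0) = (\<lambda>m. 0)"
  by (simp add: xmul_def)

lemma polP_diff: "polP (F - G) = polP F - polP G"
  by (simp add: polP_def)

lemma polP_eq_0: "fls_has_value F c \<Longrightarrow> polP F = 0"
  by (erule fls_has_value_obtain_fps) (simp add: polP_def)

declare phi_minus.simps [simp del]

definition bogoliubov :: "(nat \<times> nat) list \<Rightarrow> rat poly fls xser" where
  "bogoliubov w m = phi w m + (\<Sum>i\<in>{1..<length w}. xmul (phi (take i w)) (phi_minus (drop i w)) m)"

lemma phi_minus_Nil: "phi_minus [] = xone"
  by (subst phi_minus.simps) simp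

lemma phi_minus_eq: "w \<noteq> [] \<Longrightarrow> phi_minus w m = - polP (bogoliubov w m)"
  by (subst phi_minus.simps) (simp add: bogoliubov_def)

lemma phi_plus_eq: "phi_plus w m = bogoliubov w m - polP (bogoliubov w m)"
  by (simp add: phi_plus_def bogoliubov_def)

definition word_conv :: "('b list \<Rightarrow> 'a::comm_ring_1 xser) \<Rightarrow> ('b list \<Rightarrow> 'a xser) \<Rightarrow> 'b list \<Rightarrow> 'a xser"
  where "word_conv f g w m = (\<Sum>i\<le>length w. xmul (f (take i w)) (g (drop i w)) m)"

lemma phi_Nil: "phi [] = xone"
proof
  fix m
  show "phi [] m = xone m"
    using phi_append_zeros[of "[]" 0 m]
    by (simp add: over_ones_def index_lists_Nil xone_def fps_exp_poly_0 const_coeffs.hom_one)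
qed

lemma bogoliubov_eq_word_conv:
  assumes "w \<noteq> []" "psi [] = xone"
    and suffix: "\<And>i. 0 < i \<Longrightarrow> i < length w \<Longrightarrow> phi_minus (drop i w) = psi (drop i w)"
  shows "bogoliubov w m = word_conv phi psi w m - psi w m"
proof -
  have split: "{..length w} = insert 0 (insert (length w) {1..<length w})"
    using assms(1) by auto
  have "word_conv phi psi w m
      = psi w m + (phi w m + (\<Sum>i\<in>{1..<length w}. xmul (phi (take i w)) (psi (drop i w)) m))"
    unfolding word_conv_def split using assms(1,2) by (simp add: phi_Nil)
  also have "(\<Sum>i\<in>{1..<length w}. xmul (phi (take i w)) (psi (drop i w)) m)
      = (\<Sum>i\<in>{1..<length w}. xmul (phi (take i w)) (phi_minus (drop i w)) m)"
    using suffix by (intro sum.cong) auto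
  finally show ?thesis
    by (simp add: bogoliubov_def)
qed

lemma birkhoff_factorization_unique:
  assumes suffix: "\<And>w i. w \<in> W \<Longrightarrow> drop i w \<in> W"
    and Nil: "psi [] = xone"
    and polar: "\<And>w m. w \<in> W \<Longrightarrow> w \<noteq> [] \<Longrightarrow> polP (psi w m) = psi w m"
    and regular: "\<And>w m. w \<in> W \<Longrightarrow> w \<noteq> [] \<Longrightarrow> polP (word_conv phi psi w m) = 0"
  shows "w \<in> W \<Longrightarrow> phi_minus w = psi w"
    and "w \<in> W \<Longrightarrow> w \<noteq> [] \<Longrightarrow> phi_plus w = word_conv phi psi w"
proof -
  show minus: "phi_minus w = psi w" if "w \<in> W" for w
    using that
  proof (induction w rule: measure_induct_rule[of length])
    case (less w)
    show ?case
    proof (cases "w = []")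
      case False
      have "bogoliubov w m = word_conv phi psi w m - psi w m" for m
        using False less.prems by (intro bogoliubov_eq_word_conv Nil less.IH suffix) simp_all
      thus ?thesis
        using polar[OF less.prems False] regular[OF less.prems False]
        by (intro ext) (simp add: phi_minus_eq[OF False] polP_diff)
    qed (simp add: Nil phi_minus_Nil)
  qed
  assume w: "w \<in> W" "w \<noteq> []"
  hence "bogoliubov w m = word_conv phi psi w m - psi w m" for m
    by (intro bogoliubov_eq_word_conv Nil minus suffix)
  thus "phi_plus w = word_conv phi psi w"
    using polar[OF w] regular[OF w] by (intro ext) (simp add: phi_plus_eq polP_diff)
qed

section \<open>The renormalized monomial quasisymmetric functions\<close>

definition counterterm :: "(nat \<times> nat) list \<Rightarrow> rat poly fls xser" where
  "counterterm w = (if set (map fst w) \<subseteq> {0}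
    then \<lambda>m. if m = 0 then const_coeffs (fps_nth counterterm_fps (length w)) else 0 else (\<lambda>m. 0))"

lemma counterterm_Nil: "counterterm [] = xone"
  by (auto simp: counterterm_def xone_def counterterm_fps_nth_0 const_coeffs.hom_one)

lemma counterterm_over_ones_zeros:
  "counterterm (over_ones (replicate k 0))
    = (\<lambda>m. if m = 0 then const_coeffs (fps_nth counterterm_fps k) else 0)"
  by (auto simp: counterterm_def set_replicate_conv_if)

lemma polP_counterterm:
  assumes "w \<noteq> []"
  shows "polP (counterterm w m) = counterterm w m"
proof -
  have "fls_regpart (const_coeffs (fps_nth counterterm_fps (length w))) = 0"
    using assms by (intro fps_ext) (simp add: fls_map_nth counterterm_fps_polar)
  thus ?thesis
    by (simp add: counterterm_def polP_def)
qed

lemma word_conv_counterterm: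
  assumes u: "no_trailing ((=) 0) u"
  shows "word_conv phi counterterm (over_ones (u @ replicate k 0)) m
    = (\<Sum>l\<le>k. phi (over_ones (u @ replicate l 0)) m
        * const_coeffs (fps_nth counterterm_fps (k - l)))"
proof -
  let ?w = "over_ones (u @ replicate k 0)"
  let ?X = "\<lambda>i. xmul (phi (take i ?w)) (counterterm (drop i ?w)) m"
  have "?X i = 0" if "i < length u" for i
  proof -
    have "drop i u \<noteq> []"
      using that by simp
    hence "last (drop i u) \<in> set (drop i u)" "0 \<noteq> last (drop i u)"
      using no_trailing_drop[OF u, of i] unfolding no_trailing_unfold by (blast intro: last_in_set)+
    hence "\<not> set (map fst (drop i ?w)) \<subseteq> {0}"
      using that by (auto simp: drop_map[symmetric] simp del: set_map)
    hence "counterterm (drop i ?w) = (\<lambda>m. 0)"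
      unfolding counterterm_def by (rule if_not_P)
    thus ?thesis by simp
  qed
  hence "(\<Sum>i\<le>length u + k. ?X i) = (\<Sum>i=length u..length u + k. ?X i)"
    by (intro sum.mono_neutral_right) auto
  also have "\<dots> = (\<Sum>l\<le>k. ?X (length u + l))"
    using sum.shift_bounds_cl_nat_ivl[of ?X 0 "length u" k] by (simp add: add.commute atLeast0AtMost)
  also have "\<dots> = (\<Sum>l\<le>k. phi (over_ones (u @ replicate l 0)) m
        * const_coeffs (fps_nth counterterm_fps (k - l)))"
  proof (intro sum.cong refl)
    fix l assume "l \<in> {..k}"
    hence "take (length u + l) ?w = over_ones (u @ replicate l 0)"
      and "drop (length u + l) ?w = over_ones (replicate (k - l) 0)"
      by (simp_all add: over_ones_def take_map drop_map min_def)
    thus "?X (length u + l) = phi (over_ones (u @ replicate l 0)) m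
        * const_coeffs (fps_nth counterterm_fps (k - l))"
      by (simp only: counterterm_over_ones_zeros xmul_const)
  qed
  finally show ?thesis
    by (simp add: word_conv_def)
qed

lemma fls_has_value_word_conv_counterterm:
  assumes u: "no_trailing ((=) 0) u"
  shows "fls_has_value (word_conv phi counterterm (over_ones (u @ replicate k 0)) m)
    (\<Sum>i\<in>index_lists {0<..} u m. binomial_poly (- [:of_nat (last_index i), 1:] - [:1 / 2:]) k)"
proof -
  define E where "E = (\<lambda>i. fps_exp_poly [:of_nat (sum_list i), rat_of_nat (length u):])"
  define e where "e = (\<lambda>i. fps_to_fls (fps_exp_poly [:rat_of_nat (last_index i), 1:]))"
  define R where "R = (\<lambda>i. \<Sum>l\<le>k. e i ^ l * const_coeffs (geometric_esym l expz)
      * const_coeffs (fps_nth counterterm_fps (k - l)))"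
  have "word_conv phi counterterm (over_ones (u @ replicate k 0)) m
      = (\<Sum>i\<in>index_lists {0<..} u m. fps_to_fls (E i) * R i)"
    unfolding word_conv_counterterm[OF u] phi_append_zeros[OF u] sum_distrib_right sum_distrib_left
      R_def E_def e_def
    by (subst sum.swap) (simp add: mult.assoc)
  moreover have "fls_has_value (fps_to_fls (E i)) 1" for i
    using fls_has_value_fps_to_fls[of "E i"] by (simp add: E_def fps_exp_poly_nth_0)
  moreover have "fls_has_value (R i) (binomial_poly (- [:of_nat (last_index i), 1:] - [:1 / 2:]) k)" for i
    unfolding R_def e_def by (rule fls_has_value_renormalized_zeros)
  ultimately show ?thesis
    by (metis (no_types, lifting) fls_has_value_mult fls_has_value_sum mult_1 sum.cong)
qed

lemma obtain_trailing_zeros: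
  fixes a :: "nat list"
  obtains u k where "a = u @ replicate k 0" "no_trailing ((=) 0) u"
proof -
  obtain zs where "a = strip_while ((=) 0) a @ zs" "\<And>z. z \<in> set zs \<Longrightarrow> 0 = z"
    using strip_while_eq_obtain_trailing[of "(=) 0" a "strip_while ((=) 0) a"] by metis
  hence "a = strip_while ((=) 0) a @ replicate (length zs) 0"
    by (metis replicate_eqI)
  thus thesis by (rule that) simp
qed

lemma Mq_eq:
  assumes u: "no_trailing ((=) 0) u"
  shows "Mq (u @ replicate k 0) m
    = (\<Sum>i\<in>index_lists {0<..} u m. binomial_poly (- [:of_nat (last_index i), 1:] - [:1 / 2:]) k)"
proof (cases "u @ replicate k 0 = []")
  case True
  thus ?thesis by (auto simp: Mq_def xone_def index_lists_Nil)
next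
  case False
  have "phi_plus (over_ones (u @ replicate k 0))
      = word_conv phi counterterm (over_ones (u @ replicate k 0))"
  proof (rule birkhoff_factorization_unique(2)[where W = "range over_ones"])
    show "drop i w \<in> range over_ones" if "w \<in> range over_ones" for w i
      using that by (auto simp: over_ones_def drop_map)
    show "polP (word_conv phi counterterm w m) = 0" if w: "w \<in> range over_ones" for w m
    proof -
      obtain a where a: "w = over_ones a"
        using w by blast
      obtain v j where v: "a = v @ replicate j 0" "no_trailing ((=) 0) v"
        by (rule obtain_trailing_zeros)
      show ?thesis
        unfolding a v(1) by (rule polP_eq_0[OF fls_has_value_word_conv_counterterm[OF v(2)]])
    qed
  qed (use False in \<open>simp_all add: counterterm_Nil polP_counterterm\<close>)
  hence "Mq (u @ replicate k 0) m
      = fls_nth (word_conv phi counterterm (over_ones (u @ replicate k 0)) m) 0"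
    unfolding Mq_def Zren_def over_ones_def using False by (simp only: if_False)
  thus ?thesis
    using fls_has_value_word_conv_counterterm[OF u, of k m] by (simp add: fls_has_value_def)
qed

lemma degree_Mq: "degree (Mq a m) \<le> length a"
proof -
  obtain u k where a: "a = u @ replicate k 0" "no_trailing ((=) 0) u"
    by (rule obtain_trailing_zeros)
  have "degree (Mq a m) \<le> k"
    unfolding a(1) Mq_eq[OF a(2)]
    by (intro degree_sum_le degree_binomial_poly finite_index_lists a) auto
  thus ?thesis using a(1) by simp
qed

section \<open>Quasi-shuffle relations in finitely many variables\<close>

fun qsym_monomial :: "'a::comm_semiring_1 list \<Rightarrow> nat list \<Rightarrow> 'a" where
  "qsym_monomial ys [] = 1"
| "qsym_monomial [] (x # a) = 0"
| "qsym_monomial (y # ys) (x # a) = y ^ x * qsym_monomial ys a + qsym_monomial ys (x # a)"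

lemma qsym_monomial_quasi_shuffle:
  "qsym_monomial ys a * qsym_monomial ys b = (\<Sum>c\<in>#qsh a b. qsym_monomial ys c)"
proof (induction ys arbitrary: a b)
  case Nil
  show ?case
    by (cases a; cases b) (simp_all add: image_mset.compositionality o_def)
next
  case (Cons y ys)
  show ?case
  proof (cases "a = [] \<or> b = []")
    case True
    thus ?thesis by (cases a; cases b) auto
  next
    case False
    then obtain x a' z b' where ab: "a = x # a'" "b = z # b'"
      by (cases a; cases b) auto
    let ?M = "qsym_monomial ys"
    have split: "(\<Sum>c\<in>#C. qsym_monomial (y # ys) (v # c))
        = y ^ v * (\<Sum>c\<in>#C. ?M c) + (\<Sum>c\<in>#C. ?M (v # c))" for v C
      by (simp add: sum_mset.distrib sum_mset_distrib_left)
    have "(\<Sum>c\<in>#qsh a b. qsym_monomial (y # ys) c)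
        = y ^ x * (?M a' * ?M b) + y ^ z * (?M a * ?M b') + y ^ (x + z) * (?M a' * ?M b')
          + ((\<Sum>c\<in>#qsh a' b. ?M (x # c)) + (\<Sum>c\<in>#qsh a b'. ?M (z # c))
            + (\<Sum>c\<in>#qsh a' b'. ?M ((x + z) # c)))"
      by (simp add: ab image_mset.compositionality o_def split Cons add_ac del: qsym_monomial.simps)
    also have "(\<Sum>c\<in>#qsh a' b. ?M (x # c)) + (\<Sum>c\<in>#qsh a b'. ?M (z # c))
        + (\<Sum>c\<in>#qsh a' b'. ?M ((x + z) # c)) = ?M a * ?M b"
      using Cons[of a b] by (simp add: ab image_mset.compositionality o_def)
    also have "y ^ x * (?M a' * ?M b) + y ^ z * (?M a * ?M b') + y ^ (x + z) * (?M a' * ?M b')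
        + ?M a * ?M b = qsym_monomial (y # ys) a * qsym_monomial (y # ys) b"
      by (simp add: ab power_add algebra_simps)
    finally show ?thesis ..
  qed
qed

lemma qsym_monomial_eq_sum:
  fixes f :: "'b::linorder \<Rightarrow> 'a::comm_semiring_1"
  assumes "sorted_wrt (<) L"
  shows "qsym_monomial (map f L) a
    = (\<Sum>i\<in>strict_lists (set L) (length a). \<Prod>(n, x)\<leftarrow>zip i a. f n ^ x)"
  using assms
proof (induction L arbitrary: a)
  case Nil
  show ?case by (cases a) simp_all
next
  case (Cons n L)
  show ?case
  proof (cases a)
    case (Cons x b)
    let ?S = "strict_lists (set L)" and ?P = "\<lambda>i. \<Prod>(n, x)\<leftarrow>zip i a. f n ^ x"
    have n: "\<forall>y\<in>set L. n < y"
      using Cons.prems by simp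
    hence disjoint: "Cons n ` ?S (length b) \<inter> ?S (Suc (length b)) = {}"
      by (auto simp: strict_lists_def)
    have "(\<Sum>i\<in>strict_lists (set (n # L)) (length a). ?P i)
        = (\<Sum>i\<in>Cons n ` ?S (length b). ?P i) + (\<Sum>i\<in>?S (length a). ?P i)"
      using disjoint n by (simp add: Cons strict_lists_insert_least sum.union_disjoint finite_strict_lists)
    also have "(\<Sum>i\<in>Cons n ` ?S (length b). ?P i)
        = f n ^ x * (\<Sum>i\<in>?S (length b). \<Prod>(n, x)\<leftarrow>zip i b. f n ^ x)"
      by (simp add: sum.reindex Cons sum_distrib_left)
    finally show ?thesis
      using Cons.IH Cons.prems by (simp add: Cons)
  qed simp
qed

definition var :: "nat \<Rightarrow> xmono \<Rightarrow>\<^sub>0 nat" where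
  "var n = Poly_Mapping.single (Poly_Mapping.single n 1) 1"

lemma var_power: "var n ^ x = Poly_Mapping.single (Poly_Mapping.single n x) 1"
proof (induction x)
  case (Suc x)
  have "Poly_Mapping.single n (Suc x) = Poly_Mapping.single n 1 + Poly_Mapping.single n x"
    by (simp flip: single_add)
  thus ?case
    using Suc by (simp add: var_def mult_single del: One_nat_def)
qed (simp del: One_nat_def)

lemma prod_list_var_powers:
  "length i = length a \<Longrightarrow> (\<Prod>(n, x)\<leftarrow>zip i a. var n ^ x) = Poly_Mapping.single (mono_of i a) 1"
  by (induction i a rule: list_induct2) (simp_all add: var_power mult_single del: One_nat_def)

lemma lookup_qsym_monomial_vars:
  "Poly_Mapping.lookup (qsym_monomial (map var [1..<Suc N]) a) m = card (index_lists {1..N} a m)"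
proof -
  let ?S = "strict_lists {1..N} (length a)"
  have "qsym_monomial (map var [1..<Suc N]) a = (\<Sum>i\<in>?S. \<Prod>(n, x)\<leftarrow>zip i a. var n ^ x)"
    by (subst qsym_monomial_eq_sum) (simp_all add: atLeastLessThanSuc_atLeastAtMost del: upt_Suc)
  also have "\<dots> = (\<Sum>i\<in>?S. Poly_Mapping.single (mono_of i a) 1)"
    by (intro sum.cong refl prod_list_var_powers) (simp add: strict_lists_def)
  finally have "Poly_Mapping.lookup (qsym_monomial (map var [1..<Suc N]) a) m
      = (\<Sum>i\<in>?S. if mono_of i a = m then 1 else 0)"
    by (simp add: lookup_sum lookup_single when_def del: One_nat_def upt_Suc)
  thus ?thesis
    by (simp add: sum.If_cases finite_strict_lists index_lists_def Int_def)
qed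

lemma lookup_mult_eq_sum:
  fixes f g :: "'a::monoid_add \<Rightarrow>\<^sub>0 'b::semiring_0"
  assumes "finite {(a, b). a + b = m}"
  shows "Poly_Mapping.lookup (f * g) m
    = (\<Sum>(a, b)\<in>{(a, b). a + b = m}. Poly_Mapping.lookup f a * Poly_Mapping.lookup g b)"
proof -
  let ?h = "\<lambda>(a, b). Poly_Mapping.lookup f a * Poly_Mapping.lookup g b when m = a + b"
  have "Poly_Mapping.lookup (f * g) m = Sum_any ?h"
    by (simp add: times_poly_mapping.rep_eq prod_fun_unfold_prod)
  also have "\<dots> = sum ?h {(a, b). a + b = m}"
    using assms by (rule Sum_any.expand_superset) (auto simp: when_def split: if_splits)
  also have "\<dots> = (\<Sum>(a, b)\<in>{(a, b). a + b = m}. Poly_Mapping.lookup f a * Poly_Mapping.lookup g b)"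
    by (intro sum.cong) auto
  finally show ?thesis .
qed

lemma card_index_lists_quasi_shuffle:
  "(\<Sum>(m1, m2)\<in>{(m1, m2). m1 + m2 = m}. card (index_lists {1..N} a m1) * card (index_lists {1..N} b m2))
    = (\<Sum>c\<in>#qsh a b. card (index_lists {1..N} c m))"
proof -
  have lookup_sum_mset: "Poly_Mapping.lookup (\<Sum>c\<in>#C. F c) m = (\<Sum>c\<in>#C. Poly_Mapping.lookup (F c) m)"
    for C and F :: "nat list \<Rightarrow> xmono \<Rightarrow>\<^sub>0 nat"
    by (induction C) (simp_all add: lookup_add)
  show ?thesis
    unfolding lookup_qsym_monomial_vars [symmetric] lookup_mult_eq_sum[OF finite_add_eq, symmetric]
      qsym_monomial_quasi_shuffle lookup_sum_mset ..
qed

section \<open>Values at negative half-integers\<close>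

lemma card_index_lists_append_zeros:
  "card (index_lists {1..N} (u @ replicate k 0) m)
    = (\<Sum>i\<in>index_lists {1..N} u m. (N - last_index i) choose k)"
proof -
  let ?J = "\<lambda>i. strict_lists ({1..N} \<inter> {last_index i<..}) k"
  have "{1..N} \<inter> {n<..} = {n<..N}" for n
    by auto
  hence card: "card (?J i) = (N - last_index i) choose k" for i
    by (simp add: card_strict_lists)
  have "card (index_lists {1..N} (u @ replicate k 0) m) = card (Sigma (index_lists {1..N} u m) ?J)"
    by (subst index_lists_append_zeros) (auto intro!: card_image inj_on_append_index_lists)
  also have "\<dots> = (\<Sum>i\<in>index_lists {1..N} u m. card (?J i))"
    by (intro card_SigmaI ballI finite_strict_lists) (simp_all add: index_lists_def finite_strict_lists)
  finally show ?thesis by (simp only: card)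
qed

lemma poly_Mq:
  assumes m: "Poly_Mapping.keys m \<subseteq> {..N}"
  shows "poly (Mq a m) (- of_nat N - 1 / 2) = of_nat (card (index_lists {1..N} a m))"
proof -
  obtain u k where a: "a = u @ replicate k 0" and u: "no_trailing ((=) 0) u"
    by (rule obtain_trailing_zeros)
  have "{0<..} \<inter> {..N} = {1..N}"
    by auto
  hence I: "index_lists {0<..} u m = index_lists {1..N} u m"
    using index_lists_le_keys[OF u m, of "{0<..}"] by simp
  have last: "last_index i \<le> N" if "i \<in> index_lists {1..N} u m" for i
    using that unfolding index_lists_def strict_lists_def last_index_def
    by (auto dest!: subsetD[OF _ last_in_set])
  have "poly (Mq a m) (- of_nat N - 1 / 2)
      = (\<Sum>i\<in>index_lists {1..N} u m. (of_nat N - of_nat (last_index i)) gchoose k)"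
    unfolding a Mq_eq[OF u] I poly_sum poly_binomial_poly
    by (intro sum.cong refl arg_cong2[where f = "(gchoose)"]) (simp_all add: algebra_simps)
  also have "\<dots> = (\<Sum>i\<in>index_lists {1..N} u m. of_nat ((N - last_index i) choose k))"
    using last by (intro sum.cong refl) (simp add: binomial_gbinomial of_nat_diff)
  also have "\<dots> = of_nat (card (index_lists {1..N} a m))"
    unfolding a card_index_lists_append_zeros by simp
  finally show ?thesis .
qed

lemma poly_xmul_Mq:
  assumes m: "Poly_Mapping.keys m \<subseteq> {..N}"
  shows "poly (xmul (Mq a) (Mq b) m) (- of_nat N - 1 / 2)
    = poly (\<Sum>c\<in>#qsh a b. Mq c m) (- of_nat N - 1 / 2)"
proof -
  let ?D = "{(m1, m2). m1 + m2 = m}" and ?C = "\<lambda>a m. card (index_lists {1..N} a m)"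
  have keys: "Poly_Mapping.keys m1 \<subseteq> {..N}" "Poly_Mapping.keys m2 \<subseteq> {..N}" if "m1 + m2 = m" for m1 m2
    using m that by (auto simp: in_keys_iff lookup_add subset_iff)
  have "poly (xmul (Mq a) (Mq b) m) (- of_nat N - 1 / 2)
      = (\<Sum>(m1, m2)\<in>?D. of_nat (?C a m1 * ?C b m2))"
    unfolding xmul_def poly_sum by (intro sum.cong refl) (auto simp: poly_Mq keys)
  also have "\<dots> = of_nat (\<Sum>(m1, m2)\<in>?D. ?C a m1 * ?C b m2)"
    by (simp add: case_prod_unfold)
  also have "\<dots> = (\<Sum>c\<in>#qsh a b. poly (Mq c m) (- of_nat N - 1 / 2))"
    unfolding card_index_lists_quasi_shuffle
    by (simp add: poly_Mq[OF m] image_mset.compositionality o_def del: One_nat_def)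
  finally show ?thesis
    by (simp add: poly_sum_mset)
qed

lemma Mq_quasi_shuffle: "xmul (Mq a) (Mq b) m = (\<Sum>c\<in>#qsh a b. Mq c m)"
proof (rule poly_eqI_infinite)
  obtain N0 where "Poly_Mapping.keys m \<subseteq> {..N0}"
    using finite_nat_iff_bounded_le by (metis finite_keys)
  hence "Poly_Mapping.keys m \<subseteq> {..N}" if "N0 \<le> N" for N
    using that by (meson atMost_subset_iff order_trans)
  hence "(\<lambda>N. - of_nat N - 1 / 2) ` {N0..}
      \<subseteq> {x. poly (xmul (Mq a) (Mq b) m) x = poly (\<Sum>c\<in>#qsh a b. Mq c m) x}"
    using poly_xmul_Mq by auto
  moreover have "infinite ((\<lambda>N. - of_nat N - 1 / 2 :: rat) ` {N0..})"
    using infinite_Ici[of N0] by (subst finite_image_iff) (auto simp: inj_on_def)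
  ultimately show "infinite {x. poly (xmul (Mq a) (Mq b) m) x = poly (\<Sum>c\<in>#qsh a b. Mq c m) x}"
    by (rule infinite_super)
qed

section \<open>Extension of scalars\<close>

lemma unit_mult_right_cancel:
  fixes x y u :: "'a::comm_ring_1"
  assumes "u dvd 1" "x * u = y * u"
  shows "x = y"
proof -
  obtain v where v: "1 = u * v"
    using assms(1) by (rule dvdE)
  have "x = (x * u) * v" and "y = (y * u) * v"
    by (simp_all add: mult.assoc flip: v)
  thus ?thesis using assms(2) by simp
qed

locale rational_scalars =
  fixes scalars :: "'k::comm_ring_1 itself"
  assumes of_nat_dvd_1: "0 < n \<Longrightarrow> (of_nat n :: 'k) dvd 1"
begin

lemma of_int_dvd_1: "0 < n \<Longrightarrow> (of_int n :: 'k) dvd 1"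
  using of_nat_dvd_1[of "nat n"] by simp

lemma ratk_Fract_times_denominator:
  assumes "b > 0"
  shows "ratk (Fract a b) * of_int b = (of_int a :: 'k)"
proof -
  obtain c d where cd: "quotient_of (Fract a b) = (c, d)"
    by (cases "quotient_of (Fract a b)")
  have d: "d > 0" and "Fract a b = of_int c / of_int d"
    using quotient_of_denom_pos[OF cd] quotient_of_div[OF cd] by auto
  hence "Fract a b = Fract c d"
    by (simp add: of_int_rat)
  hence cross: "c * b = a * d"
    using d assms by (simp add: eq_rat)
  have "\<exists>y. of_int d * y = (1::'k)"
    using of_int_dvd_1[OF d] by (auto simp: dvd_def intro: sym)
  hence y: "of_int d * (SOME y. of_int d * y = (1::'k)) = 1"
    by (rule someI_ex)
  have "ratk (Fract a b) * of_int b = of_int (c * b) * (SOME y. of_int d * y = (1::'k))"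
    by (simp add: ratk_def cd mult_ac)
  also have "\<dots> = of_int a"
    using y by (simp add: cross mult.assoc)
  finally show ?thesis .
qed

lemma comm_ring_hom_ratk: "comm_ring_hom (ratk :: rat \<Rightarrow> 'k)"
proof
  note ratk = ratk_Fract_times_denominator
  show "ratk 1 = (1::'k)"
    using ratk[of 1 1] by (simp add: One_rat_def)
  fix p q :: rat
  obtain a b c d where p: "p = Fract a b" "b > 0" and q: "q = Fract c d" "d > 0"
    by (metis Rat_cases)
  hence bd: "b * d > 0" by simp
  have "ratk (p + q) * of_int (b * d) = (of_int (a * d + c * b) :: 'k)"
    using p q ratk[OF bd] by simp
  also have "\<dots> = (ratk p + ratk q) * of_int (b * d)"
    by (simp add: p q algebra_simps flip: ratk[OF p(2), of a] ratk[OF q(2), of c])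
  finally show "ratk (p + q) = (ratk p + ratk q :: 'k)"
    by (rule unit_mult_right_cancel[OF of_int_dvd_1[OF bd]])
  have "ratk (p * q) * of_int (b * d) = (of_int (a * c) :: 'k)"
    using p q ratk[OF bd] by simp
  also have "\<dots> = (ratk p * ratk q) * of_int (b * d)"
    by (simp add: p q algebra_simps flip: ratk[OF p(2), of a] ratk[OF q(2), of c])
  finally show "ratk (p * q) = (ratk p * ratk q :: 'k)"
    by (rule unit_mult_right_cancel[OF of_int_dvd_1[OF bd]])
qed

sublocale map_poly_ratk: comm_ring_hom "map_poly (ratk :: rat \<Rightarrow> 'k)"
  by (rule comm_ring_hom_map_poly[OF comm_ring_hom_ratk])

lemma Mk_quasi_shuffle: "xmul (Mk a) (Mk b) = (\<lambda>m. \<Sum>c\<in>#qsh a b. (Mk c m :: 'k poly))"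
proof
  fix m
  have "xmul (Mk a) (Mk b) m = map_poly (ratk :: rat \<Rightarrow> 'k) (xmul (Mq a) (Mq b) m)"
    by (simp add: xmul_def map_poly_ratk.hom_sum case_prod_unfold map_poly_ratk.hom_mult Mk_def)
  also have "\<dots> = (\<Sum>c\<in>#qsh a b. Mk c m)"
    by (simp only: Mq_quasi_shuffle map_poly_ratk.hom_sum_mset Mk_def)
  finally show "xmul (Mk a) (Mk b) m = (\<Sum>c\<in>#qsh a b. (Mk c m :: 'k poly))" .
qed

lemma Mk_Nil: "Mk [] = (xone :: 'k poly xser)"
  by (auto simp: Mk_def Mq_def xone_def map_poly_ratk.hom_zero map_poly_ratk.hom_one)

end

section \<open>The algebra of renormalized quasisymmetric functions\<close>

lemma Mk_in_RenQSym: "(Mk a :: 'k::comm_ring_1 poly xser) \<in> RenQSym"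
  unfolding RenQSym_def by (intro CollectI exI[of _ "{a}"] exI[of _ "\<lambda>_. 1"]) simp

lemma RenQSym_zero: "(\<lambda>m. 0) \<in> (RenQSym :: 'k::comm_ring_1 poly xser set)"
  unfolding RenQSym_def by (intro CollectI exI[of _ "{}"]) simp

lemma RenQSym_add:
  assumes "f \<in> RenQSym" "g \<in> (RenQSym :: 'k::comm_ring_1 poly xser set)"
  shows "(\<lambda>m. f m + g m) \<in> RenQSym"
proof -
  obtain S c where S: "finite S" "f = (\<lambda>m. \<Sum>a\<in>S. smult (c a) (Mk a m))"
    using assms(1) by (auto simp: RenQSym_def)
  obtain T d where T: "finite T" "g = (\<lambda>m. \<Sum>a\<in>T. smult (d a) (Mk a m))"
    using assms(2) by (auto simp: RenQSym_def)
  let ?c = "\<lambda>a. if a \<in> S then c a else 0" and ?d = "\<lambda>a. if a \<in> T then d a else 0"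
  have "f m = (\<Sum>a\<in>S \<union> T. smult (?c a) (Mk a m))" for m
    unfolding S(2) using S(1) T(1) by (intro sum.mono_neutral_cong_left) auto
  moreover have "g m = (\<Sum>a\<in>S \<union> T. smult (?d a) (Mk a m))" for m
    unfolding T(2) using S(1) T(1) by (intro sum.mono_neutral_cong_left) auto
  ultimately have "(\<lambda>m. f m + g m) = (\<lambda>m. \<Sum>a\<in>S \<union> T. smult (?c a + ?d a) (Mk a m))"
    by (simp add: sum.distrib smult_add_left)
  thus ?thesis
    unfolding RenQSym_def using S(1) T(1) by (intro CollectI exI[of _ "S \<union> T"]) auto
qed

lemma smult_sum_right: "smult c (sum f A) = (\<Sum>x\<in>A. smult c (f x))"
  by (induction A rule: infinite_finite_induct) (auto simp: smult_add_right)

lemma RenQSym_smult: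
  assumes "f \<in> (RenQSym :: 'k::comm_ring_1 poly xser set)"
  shows "(\<lambda>m. smult x (f m)) \<in> RenQSym"
proof -
  obtain S c where S: "finite S" "f = (\<lambda>m. \<Sum>a\<in>S. smult (c a) (Mk a m))"
    using assms by (auto simp: RenQSym_def)
  have "smult x (f m) = (\<Sum>a\<in>S. smult (x * c a) (Mk a m))" for m
    by (simp add: S(2) smult_sum_right)
  thus ?thesis
    unfolding RenQSym_def using S(1) by (intro CollectI exI[of _ S] exI[of _ "\<lambda>a. x * c a"]) simp
qed

lemma RenQSym_sum:
  assumes "\<And>x. x \<in> A \<Longrightarrow> F x \<in> (RenQSym :: 'k::comm_ring_1 poly xser set)"
  shows "(\<lambda>m. \<Sum>x\<in>A. F x m) \<in> RenQSym"
  using assms by (induction A rule: infinite_finite_induct) (auto intro: RenQSym_zero RenQSym_add)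

lemma RenQSym_sum_mset:
  assumes "\<And>x. x \<in># A \<Longrightarrow> F x \<in> (RenQSym :: 'k::comm_ring_1 poly xser set)"
  shows "(\<lambda>m. \<Sum>x\<in>#A. F x m) \<in> RenQSym"
  using assms by (induction A) (auto intro: RenQSym_zero RenQSym_add)

lemma xmul_linear_combinations:
  fixes F :: "'b \<Rightarrow> 'k::comm_ring_1 poly xser" and G :: "'c \<Rightarrow> 'k poly xser"
  shows "xmul (\<lambda>m. \<Sum>a\<in>S. smult (c a) (F a m)) (\<lambda>m. \<Sum>b\<in>T. smult (d b) (G b m))
    = (\<lambda>m. \<Sum>a\<in>S. \<Sum>b\<in>T. smult (c a * d b) (xmul (F a) (G b) m))"
    (is "xmul ?f ?g = ?h")
proof
  fix m :: xmono
  let ?D = "{(m1, m2). m1 + m2 = m}"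
  let ?t = "\<lambda>p a b. smult (c a * d b) (F a (fst p) * G b (snd p))"
  have "xmul ?f ?g m = (\<Sum>p\<in>?D. \<Sum>a\<in>S. \<Sum>b\<in>T. ?t p a b)"
    by (simp add: xmul_def sum_product case_prod_unfold mult_ac)
  also have "\<dots> = (\<Sum>a\<in>S. \<Sum>b\<in>T. \<Sum>p\<in>?D. ?t p a b)"
    by (subst sum.swap) (intro sum.cong refl sum.swap)
  also have "\<dots> = ?h m"
    by (simp add: xmul_def case_prod_unfold smult_sum_right)
  finally show "xmul ?f ?g m = ?h m" .
qed

lemma (in rational_scalars) RenQSym_xmul:
  assumes f: "f \<in> RenQSym" and g: "g \<in> (RenQSym :: 'k poly xser set)"
  shows "xmul f g \<in> RenQSym"
proof -
  obtain S c where S: "f = (\<lambda>m. \<Sum>a\<in>S. smult (c a) (Mk a m))"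
    using f by (auto simp: RenQSym_def)
  obtain T d where T: "g = (\<lambda>m. \<Sum>a\<in>T. smult (d a) (Mk a m))"
    using g by (auto simp: RenQSym_def)
  show ?thesis
    unfolding S T xmul_linear_combinations Mk_quasi_shuffle
    by (intro RenQSym_sum RenQSym_smult RenQSym_sum_mset Mk_in_RenQSym)
qed

lemma RenQSym_degree_bounded:
  assumes "f \<in> (RenQSym :: 'k::comm_ring_1 poly xser set)"
  shows "\<exists>N. \<forall>m. degree (f m) \<le> N"
proof -
  obtain S c where S: "finite S" "f = (\<lambda>m. \<Sum>a\<in>S. smult (c a) (Mk a m))"
    using assms by (auto simp: RenQSym_def)
  have "degree (f m) \<le> (\<Sum>a\<in>S. length a)" for m
    unfolding S(2)
  proof (rule degree_sum_le)
    fix a assume "a \<in> S"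
    have "degree (smult (c a) (Mk a m)) \<le> degree (Mk a m :: 'k poly)"
      by (rule degree_smult_le)
    also have "\<dots> \<le> degree (Mq a m)"
      unfolding Mk_def by (rule map_poly_degree_leq)
    also have "\<dots> \<le> length a"
      by (rule degree_Mq)
    also have "\<dots> \<le> (\<Sum>a\<in>S. length a)"
      using S(1) \<open>a \<in> S\<close> by (intro member_le_sum) auto
    finally show "degree (smult (c a) (Mk a m)) \<le> (\<Sum>a\<in>S. length a)" .
  qed (rule S(1))
  thus ?thesis by blast
qed

theorem theorem5p1:
  fixes \<alpha> \<beta> :: "nat list"
  assumes "\<And>n::nat. 0 < n \<Longrightarrow> (of_nat n :: 'k::comm_ring_1) dvd 1"
    and "(1::'k) \<noteq> 0"
  shows "xmul (Mk \<alpha>) (Mk \<beta>) = (\<lambda>m. \<Sum>\<gamma>\<in>#qsh \<alpha> \<beta>. (Mk \<gamma> m :: 'k poly))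
    \<and> (RenQSym :: 'k poly xser set) \<subseteq> {f. \<exists>N. \<forall>m. degree (f m) \<le> N}
    \<and> xone \<in> (RenQSym :: 'k poly xser set)
    \<and> (\<forall>f\<in>(RenQSym :: 'k poly xser set). \<forall>g\<in>RenQSym.
          (\<lambda>m. f m + g m) \<in> RenQSym \<and> xmul f g \<in> RenQSym)
    \<and> (\<forall>c f. f \<in> (RenQSym :: 'k poly xser set) \<longrightarrow> (\<lambda>m. smult c (f m)) \<in> RenQSym)"
proof -
  interpret rational_scalars "TYPE('k)"
    by standard (rule assms(1))
  show ?thesis
  proof (intro conjI ballI allI impI subsetI CollectI)
    show "xmul (Mk \<alpha>) (Mk \<beta>) = (\<lambda>m. \<Sum>\<gamma>\<in>#qsh \<alpha> \<beta>. (Mk \<gamma> m :: 'k poly))"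
      by (rule Mk_quasi_shuffle)
    show "xone \<in> (RenQSym :: 'k poly xser set)"
      unfolding Mk_Nil[symmetric] by (rule Mk_in_RenQSym)
    fix f :: "'k poly xser" assume f: "f \<in> RenQSym"
    show "\<exists>N. \<forall>m. degree (f m) \<le> N"
      using f by (rule RenQSym_degree_bounded)
    show "(\<lambda>m. smult c (f m)) \<in> RenQSym" for c
      using f by (rule RenQSym_smult)
    fix g :: "'k poly xser" assume g: "g \<in> RenQSym"
    show "(\<lambda>m. f m + g m) \<in> RenQSym"
      using f g by (rule RenQSym_add)
    show "xmul f g \<in> RenQSym"
      using f g by (rule RenQSym_xmul)
  qed
qed

end
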